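(* For all $v\in\{1,2,\dots,V\}$ we have $\Omega_{V,v}=\Omega_{V,1}$. Moreover, suppose that $\mathcal{P}^{a}=\dfrac{P_{n_1}P_{n_2}\cdots P_{n_V}}{V^{MV}}$ for every $a\in\mathcal{A}$ (where $n_1,\dots,n_V$ are the first entries of the components $a_1,\dots,a_V$ of $a$). Let $x^{(1)}\in\Omega^V$ be any initial grove, and let $x^{(l+1)}=\eta^{a^{(l)}}(x^{(l)})$ for $l\ge 1$, where $a^{(1)},a^{(2)},\dots$ are chosen independently from $\mathcal{A}$ with probabilities $\{\mathcal{P}^a\}_{a\in\mathcal{A}}$. Then, almost surely, for every $v\in\{1,\dots,V\}$ the empirical measures $\frac1n\sum_{l=1}^n\delta_{x^{(l)}_v}$ on $\Omega$ of the $v$-th components converge weakly, as $n\to\infty$, to $\rho_V$ (the same limit for each $v$).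
   Context: IFS. An IFS (with probabilities) on a compact metric space $Y$ is a finite family of contraction maps $g_a:Y\to Y$ together with probabilities $p_a\ge 0$, $\sum_a p_a=1$. Its set attractor is the unique non-empty compact $A\subset Y$ with $A=\bigcup_a g_a(A)$; its measure attractor is the unique Borel probability measure $\mu$ on $Y$ with $\mu=\sum_a p_a\, g_a(\mu)$, where $g(\mu)=\mu\circ g^{-1}$. Code trees. $M,N,V$ are positive integers with $M\ge 2$. $T$ is the set of all finite sequences over $\{1,\dots,M\}$, including the empty sequence $\emptyset$; $|i|$ is the length of $i\in T$ and $ij$ denotes concatenation. A code tree is a function $\tau:T\to\{1,\dots,N\}$; $\Omega$ is the set of all code trees with metric $d_\Omega(\omega,\varkappa)=M^{-k}$ for $\omega\ne\varkappa$, where $k$ is the least integer such that $\omega(i)\neq\varkappa(i)$ for some $i\in T$ with $|i|=k$. $\Omega^V$ is the $V$-fold product with the maximum metric; its elements are called groves. The IFS $\Phi$. $\mathcal{A}=\{\{1,\dots,N\}\times\{1,\dots,V\}^M\}^V$; write $a=(a_1,\dots,a_V)\in\mathcal{A}$ with $a_v=(n_v;v_{v,1},\dots,v_{v,M})$. For $n\in\{1,\dots,N\}$ define $\xi_n:\Omega^M\to\Omega$ by $(\xi_n(\omega))(\emptyset)=n$ and $(\xi_n(\omega))(mi)=\omega_m(i)$ for $i\in T$, $m\in\{1,\dots,M\}$. For $a\in\mathcal{A}$ define $\eta^a:\Omega^V\to\Omega^V$ by letting the $v$-th component of $\eta^a(\omega_1,\dots,\omega_V)$ be $\xi_{n_v}(\omega_{v_{v,1}},\dots,\omega_{v_{v,M}})$.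 Let $\{\mathcal{P}^a\}_{a\in\mathcal{A}}$ be probabilities ($\mathcal P^a\ge0$, $\sum_a\mathcal P^a=1$). $\Phi=\{\Omega^V;\eta^a,\mathcal{P}^a,a\in\mathcal{A}\}$ is an IFS of contractions; its set attractor is $\Omega_V\subset\Omega^V$ and its measure attractor is $\mu_V$. $\Omega_{V,v}\subset\Omega$ is the set of $v$-th components of elements of $\Omega_V$ (elements of $\Omega_{V,1}$ are called $V$-trees). $\rho_V(B):=\mu_V(B\times\Omega\times\cdots\times\Omega)$ for Borel $B\subset\Omega$. $P_1,\dots,P_N>0$ are fixed with $\sum_n P_n=1$. *)

theory Defs
  imports "HOL-Probability.Probability"
begin

section \<open>Measures on metric spaces\<close>

definition metric_borel :: "'a set \<Rightarrow> ('a \<Rightarrow> 'a \<Rightarrow> real) \<Rightarrow> 'a measure" where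
  "metric_borel Y d = sigma Y {U. openin (Metric_space.mtopology Y d) U}"

definition weighted_sum_measure ::
    "'a measure \<Rightarrow> 'i set \<Rightarrow> ('i \<Rightarrow> real) \<Rightarrow> ('i \<Rightarrow> 'a measure) \<Rightarrow> 'a measure" where
  "weighted_sum_measure B I p \<nu> =
     measure_of (space B) (sets B) (\<lambda>E. \<Sum>i\<in>I. ennreal (p i) * emeasure (\<nu> i) E)"

definition weakly_converges :: "'a topology \<Rightarrow> (nat \<Rightarrow> 'a measure) \<Rightarrow> 'a measure \<Rightarrow> bool" where
  "weakly_converges X \<nu> \<nu>' \<longleftrightarrow>
     (\<forall>f. continuous_map X euclideanreal f \<and> bounded (f ` topspace X) \<longrightarrow>
        (\<lambda>n. \<integral>x. f x \<partial>(\<nu> n)) \<longlonglongrightarrow> (\<integral>x. f x \<partial>\<nu>'))"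

text \<open>The empirical measure of the first \<open>n\<close> terms of a sequence indexed from 1.\<close>

definition empirical_measure :: "'a measure \<Rightarrow> (nat \<Rightarrow> 'a) \<Rightarrow> nat \<Rightarrow> 'a measure" where
  "empirical_measure B x n = weighted_sum_measure B {1..n} (\<lambda>_. 1 / real n) (\<lambda>l. return B (x l))"

section \<open>Attractors of an IFS\<close>

text \<open>An IFS on the metric space \<open>(Y, d)\<close> is given by a finite index set \<open>I\<close>, maps \<open>g\<close> and
  probabilities \<open>p\<close>. If \<open>Y\<close> is compact and non-empty and the maps are contractions of \<open>Y\<close>, both
  descriptions below are uniquely satisfied (Hutchinson).\<close>

definition set_attractor ::
    "'a set \<Rightarrow> ('a \<Rightarrow> 'a \<Rightarrow> real) \<Rightarrow> 'i set \<Rightarrow> ('i \<Rightarrow> 'a \<Rightarrow> 'a) \<Rightarrow> 'a set" where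
  "set_attractor Y d I g =
     (THE A. A \<noteq> {} \<and> compactin (Metric_space.mtopology Y d) A \<and> A = (\<Union>a\<in>I. g a ` A))"

definition measure_attractor ::
    "'a set \<Rightarrow> ('a \<Rightarrow> 'a \<Rightarrow> real) \<Rightarrow> 'i set \<Rightarrow> ('i \<Rightarrow> 'a \<Rightarrow> 'a) \<Rightarrow> ('i \<Rightarrow> real) \<Rightarrow> 'a measure" where
  "measure_attractor Y d I g p =
     (THE \<mu>. prob_space \<mu> \<and> sets \<mu> = sets (metric_borel Y d) \<and>
        \<mu> = weighted_sum_measure (metric_borel Y d) I p (\<lambda>a. distr \<mu> (metric_borel Y d) (g a)))"

section \<open>Code trees and groves\<close>

text \<open>The set of finite sequences over \<open>{1..M}\<close> is \<open>lists {1..M}\<close>. Functions on it, on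
  \<open>{1..M}\<close> and on \<open>{1..V}\<close> are represented by functions that are \<open>undefined\<close> outside
  their domain, so that equality of functions is equality on the domain.\<close>

type_synonym code_tree = "nat list \<Rightarrow> nat"
type_synonym grove = "nat \<Rightarrow> code_tree"
type_synonym grove_index = "nat \<Rightarrow> nat \<times> (nat \<Rightarrow> nat)"

definition code_trees :: "nat \<Rightarrow> nat \<Rightarrow> code_tree set" where
  "code_trees M N = lists {1..M} \<rightarrow>\<^sub>E {1..N}"

definition tree_dist :: "nat \<Rightarrow> code_tree \<Rightarrow> code_tree \<Rightarrow> real" where
  "tree_dist M \<omega> \<kappa> =
     (if \<omega> = \<kappa> then 0
      else 1 / real M ^ (LEAST k. \<exists>i\<in>lists {1..M}. length i = k \<and> \<omega> i \<noteq> \<kappa> i))"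

definition groves :: "nat \<Rightarrow> nat \<Rightarrow> nat \<Rightarrow> grove set" where
  "groves M N V = {1..V} \<rightarrow>\<^sub>E code_trees M N"

definition grove_dist :: "nat \<Rightarrow> nat \<Rightarrow> grove \<Rightarrow> grove \<Rightarrow> real" where
  "grove_dist M V x y = Max ((\<lambda>v. tree_dist M (x v) (y v)) ` {1..V})"

section \<open>The IFS on groves\<close>

text \<open>\<open>a v = (n\<^sub>v, (v\<^sub>v\<^sub>,\<^sub>1, \<dots>, v\<^sub>v\<^sub>,\<^sub>M))\<close>.\<close>

definition grove_indices :: "nat \<Rightarrow> nat \<Rightarrow> nat \<Rightarrow> grove_index set" where
  "grove_indices M N V = {1..V} \<rightarrow>\<^sub>E ({1..N} \<times> ({1..M} \<rightarrow>\<^sub>E {1..V}))"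

definition tree_join :: "nat \<Rightarrow> nat \<Rightarrow> (nat \<Rightarrow> code_tree) \<Rightarrow> code_tree" where
  "tree_join M n \<omega> = (\<lambda>i\<in>lists {1..M}. case i of [] \<Rightarrow> n | m # j \<Rightarrow> \<omega> m j)"

definition grove_map :: "nat \<Rightarrow> nat \<Rightarrow> grove_index \<Rightarrow> grove \<Rightarrow> grove" where
  "grove_map M V a \<omega> = (\<lambda>v\<in>{1..V}. tree_join M (fst (a v)) (\<lambda>m\<in>{1..M}. \<omega> (snd (a v) m)))"

definition grove_attractor :: "nat \<Rightarrow> nat \<Rightarrow> nat \<Rightarrow> grove set" where
  "grove_attractor M N V =
     set_attractor (groves M N V) (grove_dist M V) (grove_indices M N V) (grove_map M V)"

definition grove_measure :: "nat \<Rightarrow> nat \<Rightarrow> nat \<Rightarrow> (grove_index \<Rightarrow> real) \<Rightarrow> grove measure" where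
  "grove_measure M N V p =
     measure_attractor (groves M N V) (grove_dist M V) (grove_indices M N V) (grove_map M V) p"

definition component_trees :: "nat \<Rightarrow> nat \<Rightarrow> nat \<Rightarrow> nat \<Rightarrow> code_tree set" where
  "component_trees M N V v = (\<lambda>x. x v) ` grove_attractor M N V"

definition tree_borel :: "nat \<Rightarrow> nat \<Rightarrow> code_tree measure" where
  "tree_borel M N = metric_borel (code_trees M N) (tree_dist M)"

text \<open>The first marginal of the measure attractor:
  \<open>\<rho>\<^sub>V B = \<mu>\<^sub>V (B \<times> \<Omega> \<times> \<dots> \<times> \<Omega>)\<close>.\<close>

definition tree_measure :: "nat \<Rightarrow> nat \<Rightarrow> nat \<Rightarrow> (grove_index \<Rightarrow> real) \<Rightarrow> code_tree measure" where
  "tree_measure M N V p = distr (grove_measure M N V p) (tree_borel M N) (\<lambda>x. x 1)"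

end

theory Submission
  imports Defs
begin

text \<open>A sequence \<open>s\<close> of grove indices codes the grove
  \<open>\<pi>(s) = lim \<eta>\<^bsup>s 0\<^esup> \<circ> \<dots> \<circ> \<eta>\<^bsup>s k\<^esup>\<close>, whose labels at words of length less than \<open>k\<close> depend only
  on \<open>s 0, \<dots>, s (k - 1)\<close>. The set attractor is the range of \<open>\<pi>\<close>, and the measure attractor is the
  image under \<open>\<pi>\<close> of the product measure. Replacing the component \<open>a\<^sub>w\<close> of an index by \<open>a\<^sub>v\<close> moves the
  \<open>v\<close>-th tree of a grove of the attractor to position \<open>w\<close>, so all component sets agree; for the
  given weights, exchanging \<open>a\<^sub>v\<close> and \<open>a\<^sub>w\<close> preserves the probabilities, so all marginals agree.

  Up to level \<open>k\<close>, the grove at time \<open>l + k\<close> is coded by the reversed word of the last \<open>k\<close> indices. Each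
  word of length \<open>k\<close> almost surely occurs with its expected frequency: occurrences at times in a fixed
  residue class modulo \<open>k + 1\<close> are independent, and Hoeffding's inequality and the Borel-Cantelli
  lemma apply. As a continuous function on the compact space of code trees is uniformly
  approximated by its values at coded groves of finite words, the empirical averages converge.\<close>

section \<open>Frequencies of words in an independent sequence\<close>

text \<open>Split the indices below \<open>n\<close> by their residue modulo \<open>k\<close>. Each
  class holds a share tending to 1/k of the indices, so the full average is a combination of the
  class averages with weights tending to 1/k.\<close>

lemma average_residue_classes:
  fixes y :: "nat \<Rightarrow> real"
  assumes "k > 0"
    and lim: "\<And>r. r < k \<Longrightarrow> (\<lambda>m. (\<Sum>j<m. y (r + j * k)) / real m) \<longlonglongrightarrow> L"
  shows "(\<lambda>n. (\<Sum>l<n. y l) / real n) \<longlonglongrightarrow> L"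
proof -
  \<comment> \<open>For r < k, \<open>c r n\<close> counts the l < n congruent to \<open>r\<close>
    modulo \<open>k\<close>, which is (n - r) / k rounded up.\<close>
  define c where "c = (\<lambda>r n. (n + (k - 1 - r)) div k)"
  have c_eq: "c r n = n div k + (if r < n mod k then 1 else 0)" if "r < k" for r n
  proof -
    have "n + (k - 1 - r) = (n mod k + (k - 1 - r)) + k * (n div k)"
      using mult_div_mod_eq[of k n] by linarith
    then have "c r n = n div k + (n mod k + (k - 1 - r)) div k"
      unfolding c_def using assms(1) by (metis div_mult_self2 not_gr_zero)
    moreover have "(n mod k + (k - 1 - r)) div k = (if r < n mod k then 1 else 0)"
    proof (cases "r < n mod k")
      case True
      have "n mod k < k" using assms(1) by simp
      then have "n mod k + (k - 1 - r) < 2 * k" "k \<le> n mod k + (k - 1 - r)"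
        using True that by linarith+
      then show ?thesis using True by (simp add: div_nat_eqI)
    next
      case False
      then show ?thesis using that by auto
    qed
    ultimately show ?thesis by simp
  qed
  have c_Suc: "c r (Suc n) = (if r = n mod k then Suc (c r n) else c r n)" if "r < k" for r n
    unfolding c_eq[OF that] using that by (auto simp: mod_Suc div_Suc)
  have c_last: "c (n mod k) n = n div k" for n
    using assms(1) by (simp add: c_eq)
  have sum_eq: "(\<Sum>l<n. y l) = (\<Sum>r<k. \<Sum>j<c r n. y (r + j * k))" for n
  proof (induction n)
    case 0
    have "c r 0 = 0" if "r < k" for r using c_eq[OF that, of 0] by simp
    then show ?case by simp
  next
    case (Suc n)
    have "(\<Sum>r<k. \<Sum>j<c r (Suc n). y (r + j * k)) =
        (\<Sum>r<k. (\<Sum>j<c r n. y (r + j * k)) + (if r = n mod k then y n else 0))"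
    proof (intro sum.cong refl)
      fix r assume "r \<in> {..<k}"
      then show "(\<Sum>j<c r (Suc n). y (r + j * k)) =
          (\<Sum>j<c r n. y (r + j * k)) + (if r = n mod k then y n else 0)"
        by (cases "r = n mod k") (simp_all add: c_Suc c_last)
    qed
    also have "\<dots> = (\<Sum>r<k. \<Sum>j<c r n. y (r + j * k)) + y n"
      using assms(1) by (simp add: sum.distrib)
    finally show ?case using Suc by simp
  qed
  have c_bounds: "real n / real k - 1 \<le> real (c r n)" "real (c r n) \<le> real n / real k + 1"
    if "r < k" for r n
  proof -
    have e: "real n / real k = real (n div k) + real (n mod k) / real k"
      using assms(1) by (metis mod_div_decomp of_nat_add of_nat_mult add_divide_distrib
        nonzero_mult_div_cancel_right of_nat_0_less_iff less_numeral_extra(3))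
    moreover have "0 \<le> real (n mod k) / real k" "real (n mod k) / real k < 1"
      using assms(1) by auto
    ultimately show "real n / real k - 1 \<le> real (c r n)" "real (c r n) \<le> real n / real k + 1"
      unfolding c_eq[OF that] by auto
  qed
  have c_lim: "(\<lambda>n. real (c r n) / real n) \<longlonglongrightarrow> 1 / real k" if "r < k" for r
  proof (rule tendsto_sandwich)
    show "(\<lambda>n. 1 / real k - 1 / real n) \<longlonglongrightarrow> 1 / real k"
      using tendsto_diff[OF tendsto_const lim_1_over_n] by simp
    show "(\<lambda>n. 1 / real k + 1 / real n) \<longlonglongrightarrow> 1 / real k"
      using tendsto_add[OF tendsto_const lim_1_over_n] by simp
    show "\<forall>\<^sub>F n in sequentially. 1 / real k - 1 / real n \<le> real (c r n) / real n"
      using eventually_gt_at_top[of 0]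
    proof eventually_elim
      case (elim n)
      have "1 / real k - 1 / real n = (real n / real k - 1) / real n"
        using elim by (simp add: diff_divide_distrib)
      also have "\<dots> \<le> real (c r n) / real n"
        by (intro divide_right_mono c_bounds that) simp
      finally show ?case .
    qed
    show "\<forall>\<^sub>F n in sequentially. real (c r n) / real n \<le> 1 / real k + 1 / real n"
      using eventually_gt_at_top[of 0]
    proof eventually_elim
      case (elim n)
      have "real (c r n) / real n \<le> (real n / real k + 1) / real n"
        by (intro divide_right_mono c_bounds that) simp
      also have "\<dots> = 1 / real k + 1 / real n"
        using elim by (simp add: add_divide_distrib)
      finally show ?case .
    qed
  qed
  have c_top: "filterlim (c r) sequentially sequentially" if "r < k" for r
    unfolding filterlim_at_top
  proof
    fix Z
    show "\<forall>\<^sub>F n in sequentially. Z \<le> c r n"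
      using eventually_ge_at_top[of "Z * k"]
    proof eventually_elim
      case (elim n)
      then have "Z \<le> n div k" using assms(1) by (simp add: less_eq_div_iff_mult_less_eq)
      then show ?case by (simp add: c_eq[OF that])
    qed
  qed
  \<comment> \<open>Each summand is the average over a class times the share of the class.\<close>
  have weighted: "(\<lambda>n. \<Sum>r<k. (\<Sum>j<c r n. y (r + j * k)) / real (c r n) * (real (c r n) / real n))
      \<longlonglongrightarrow> (\<Sum>r<k. L * (1 / real k))"
    by (intro tendsto_sum tendsto_mult c_lim filterlim_compose[OF lim c_top]) auto
  have "(\<Sum>r<k. (\<Sum>j<c r n. y (r + j * k)) / real (c r n) * (real (c r n) / real n)) =
      (\<Sum>l<n. y l) / real n" for n
  proof -
    have "(\<Sum>j<c r n. y (r + j * k)) / real (c r n) * (real (c r n) / real n) =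
        (\<Sum>j<c r n. y (r + j * k)) / real n" for r
      \<comment> \<open>If the class is still empty, both sides vanish: the sum is empty and
        division by 0 gives 0.\<close>
      by (cases "c r n = 0") simp_all
    then show ?thesis
      by (simp only: sum_eq[of n] sum_divide_distrib[of "\<lambda>r. \<Sum>j<c r n. y (r + j * k)"])
  qed
  then have "(\<lambda>n. (\<Sum>l<n. y l) / real n) \<longlonglongrightarrow> (\<Sum>r<k. L * (1 / real k))"
    by (intro Lim_transform_eventually[OF weighted] always_eventually allI)
  then show ?thesis using assms(1) by simp
qed

text \<open>Hoeffding's inequality bounds the probability of a deviation of size e n by a term
  geometric in \<open>n\<close>, so the deviations are summable and Borel-Cantelli applies.
  Independence, values in the unit interval and a common mean suffice.\<close>

lemma (in prob_space) strong_law_unit_interval: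
  fixes X :: "nat \<Rightarrow> 'a \<Rightarrow> real"
  assumes indep: "indep_vars (\<lambda>_. borel) X UNIV"
    and bounds: "\<And>i s. s \<in> space M \<Longrightarrow> X i s \<in> {0..1}"
    and mean: "\<And>i. expectation (X i) = \<mu>"
  shows "AE s in M. (\<lambda>n. (\<Sum>i<n. X i s) / real n) \<longlonglongrightarrow> \<mu>"
proof -
  have [measurable]: "X i \<in> borel_measurable M" for i
    using indep unfolding indep_vars_def by auto
  have dev: "AE s in M. \<forall>\<^sub>F n in sequentially. \<bar>(\<Sum>i<n. X i s) - real n * \<mu>\<bar> < e * real n"
    if "e > 0" for e
  proof -
    define A where "A = (\<lambda>n. {s \<in> space M. \<bar>(\<Sum>i<n. X i s) - real n * \<mu>\<bar> \<ge> e * real n})"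
    have [measurable]: "A n \<in> events" for n unfolding A_def by measurable
    have A_le: "prob (A n) \<le> 2 * exp (- 2 * e\<^sup>2) ^ n" for n
    proof (cases "n = 0")
      \<comment> \<open>For n = 0 the squared ranges in the exponent sum to 0, so the trivial bound
        1 is used.\<close>
      case True
      have "prob (A n) \<le> 1" by (rule prob_le_1)
      also have "1 \<le> 2 * exp (- 2 * e\<^sup>2) ^ n" by (simp add: True)
      finally show ?thesis .
    next
      case False
      interpret Hoeffding_ineq M "{..<n}" X "\<lambda>_. 0" "\<lambda>_. 1" "real n * \<mu>"
        by unfold_locales (use bounds indep_vars_subset[OF indep] mean in auto)
      have "prob (A n) \<le> 2 * exp (- 2 * (e * real n)\<^sup>2 / (\<Sum>i<n. (1 - 0)\<^sup>2))"
        unfolding A_def by (rule Hoeffding_ineq_abs_ge) (use \<open>e > 0\<close> False in auto)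
      also have "- 2 * (e * real n)\<^sup>2 / (\<Sum>i<n. (1 - 0)\<^sup>2) = real n * (- 2 * e\<^sup>2)"
        using False by (simp add: power2_eq_square)
      finally show ?thesis by (simp only: exp_of_nat_mult)
    qed
    have "summable (\<lambda>n. prob (A n))"
    proof (rule summable_comparison_test')
      show "summable (\<lambda>n. 2 * exp (- 2 * e\<^sup>2) ^ n)"
        using \<open>e > 0\<close> by (intro summable_mult summable_geometric) auto
      show "\<And>n. n \<ge> 0 \<Longrightarrow> norm (prob (A n)) \<le> 2 * exp (- 2 * e\<^sup>2) ^ n"
        using A_le by simp
    qed
    then have "AE s in M. \<forall>\<^sub>F n in sequentially. s \<in> space M - A n"
      by (intro borel_cantelli_AE1) (auto simp: emeasure_eq_measure)
    then show ?thesis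
    proof eventually_elim
      case (elim s)
      then show ?case by eventually_elim (auto simp: A_def)
    qed
  qed
  \<comment> \<open>The tolerances 1/(q + 1) tend to 0 and are countably many, so one null set
    serves all of them.\<close>
  have "AE s in M. \<forall>q::nat. \<forall>\<^sub>F n in sequentially. \<bar>(\<Sum>i<n. X i s) - real n * \<mu>\<bar> < inverse (real (Suc q)) * real n"
    unfolding AE_all_countable by (intro allI dev) auto
  then show ?thesis
  proof eventually_elim
    case (elim s)
    show ?case
    proof (rule tendstoI)
      fix e :: real assume "e > 0"
      then obtain q where q: "inverse (real (Suc q)) < e" using reals_Archimedean by blast
      from elim have "\<forall>\<^sub>F n in sequentially. \<bar>(\<Sum>i<n. X i s) - real n * \<mu>\<bar> < inverse (real (Suc q)) * real n"
        by blast
      then show "\<forall>\<^sub>F n in sequentially. dist ((\<Sum>i<n. X i s) / real n) \<mu> < e"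
        using eventually_gt_at_top[of 0]
      proof eventually_elim
        case (elim n)
        have "dist ((\<Sum>i<n. X i s) / real n) \<mu> = \<bar>(\<Sum>i<n. X i s) - real n * \<mu>\<bar> / real n"
        proof -
          have "(\<Sum>i<n. X i s) / real n - \<mu> = ((\<Sum>i<n. X i s) - real n * \<mu>) / real n"
            using elim by (simp add: diff_divide_distrib)
          then show ?thesis by (simp add: dist_real_def)
        qed
        also have "\<dots> < inverse (real (Suc q))"
          using elim by (simp add: divide_less_eq)
        finally show ?case using q by simp
      qed
    qed
  qed
qed

text \<open>The word is read backwards in time: \<open>w 0\<close> is compared with the latest index
  of the window l, ..., l + k - 1. Windows that do not overlap give independent occurrences, so the
  strong law applies along each residue class of starting times and the classes are then
  averaged.\<close>

lemma (in prob_space) word_frequency: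
  fixes \<alpha> :: "nat \<Rightarrow> 'a \<Rightarrow> 'b"
  assumes indep: "indep_vars (\<lambda>_. count_space I) \<alpha> {1..}"
    and law: "\<And>l a. l \<ge> 1 \<Longrightarrow> a \<in> I \<Longrightarrow> prob {s \<in> space M. \<alpha> l s = a} = p a"
    and w: "\<And>i. i < k \<Longrightarrow> w i \<in> I"
  shows "AE s in M. (\<lambda>n. (\<Sum>l=1..n. of_bool (\<forall>i<k. \<alpha> (l + k - 1 - i) s = w i)) / real n)
           \<longlonglongrightarrow> (\<Prod>i<k. p (w i))"
proof -
  define Y :: "nat \<Rightarrow> 'a \<Rightarrow> real"
    where "Y = (\<lambda>l s. of_bool (\<forall>i<k. \<alpha> (Suc l + k - 1 - i) s = w i))"
  \<comment> \<open>Times are shifted by one: \<open>Y l\<close> concerns the window that starts at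
    time l + 1, and the letter compared at time \<open>j\<close> of that window is
    \<open>w (l + k - j)\<close>.\<close>
  define K where "K = (\<lambda>l. {Suc l..<Suc l + k})"
  \<comment> \<open>Writing \<open>Y l\<close> as a measurable function of the restriction of
    \<open>\<alpha>\<close> to the window lets independence pass from disjoint windows to the
    variables \<open>Y\<close>.\<close>
  define h :: "nat \<Rightarrow> (nat \<Rightarrow> 'b) \<Rightarrow> real"
    where "h = (\<lambda>l. indicator (\<Pi>\<^sub>E j\<in>K l. {w (l + k - j)}))"
  have wK: "w (l + k - j) \<in> I" if "j \<in> K l" for l j
    using that by (intro w) (auto simp: K_def)
  have block: "(\<forall>i<k. \<alpha> (Suc l + k - 1 - i) s = w i) \<longleftrightarrow> (\<forall>j\<in>K l. \<alpha> j s = w (l + k - j))" for l s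
  proof safe
    fix j assume a: "\<forall>i<k. \<alpha> (Suc l + k - 1 - i) s = w i" "j \<in> K l"
    then have "l + k - j < k" "Suc l + k - 1 - (l + k - j) = j" by (auto simp: K_def)
    with a show "\<alpha> j s = w (l + k - j)" by metis
  next
    fix i assume a: "\<forall>j\<in>K l. \<alpha> j s = w (l + k - j)" "i < k"
    then have "Suc l + k - 1 - i \<in> K l" "l + k - (Suc l + k - 1 - i) = i" by (auto simp: K_def)
    with a show "\<alpha> (Suc l + k - 1 - i) s = w i" by metis
  qed
  have Y_h: "Y l s = h l (\<lambda>j\<in>K l. \<alpha> j s)" for l s
    unfolding Y_def h_def block by (auto simp: indicator_def PiE_iff)
  have [measurable]: "h l \<in> borel_measurable (Pi\<^sub>M (K l) (\<lambda>_. count_space I))" for l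
    unfolding h_def by (intro borel_measurable_indicator sets_PiM_I_finite) (auto simp: K_def wK)
  have mean: "expectation (Y l) = (\<Prod>i<k. p (w i))" for l
  proof -
    have [measurable]: "\<alpha> j \<in> measurable M (count_space I)" if "j \<in> K l" for j
      using indep that unfolding indep_vars_def by (auto simp: K_def)
    have ev: "{s \<in> space M. \<alpha> j s = w (l + k - j)} = \<alpha> j -` {w (l + k - j)} \<inter> space M" for j by auto
    have "expectation (Y l) = expectation (indicator (\<Inter>j\<in>K l. {s \<in> space M. \<alpha> j s = w (l + k - j)}))"
      unfolding Y_def block by (intro Bochner_Integration.integral_cong) (auto simp: indicator_def)
    also have "\<dots> = prob ((\<Inter>j\<in>K l. {s \<in> space M. \<alpha> j s = w (l + k - j)}) \<inter> space M)"
      by simp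
    also have "\<dots> = (\<Prod>j\<in>K l. p (w (l + k - j)))"
    proof (cases "k = 0")
      \<comment> \<open>The empty intersection is the whole type; cut with \<open>space M\<close> it
        has probability 1, the value of the empty product.\<close>
      case True
      then show ?thesis by (simp add: K_def prob_space)
    next
      case False
      then have ne: "K l \<noteq> {}" by (auto simp: K_def)
      have "(\<Inter>j\<in>K l. {s \<in> space M. \<alpha> j s = w (l + k - j)}) \<inter> space M =
          (\<Inter>j\<in>K l. \<alpha> j -` {w (l + k - j)} \<inter> space M)"
        using ne by auto
      also have "prob \<dots> = (\<Prod>j\<in>K l. prob (\<alpha> j -` {w (l + k - j)} \<inter> space M))"
        using ne wK by (intro indep_varsD[OF indep]) (auto simp: K_def)
      also have "\<dots> = (\<Prod>j\<in>K l. p (w (l + k - j)))"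
        using wK by (intro prod.cong refl) (simp add: law K_def flip: ev)
      finally show ?thesis .
    qed
    also have "\<dots> = (\<Prod>i<k. p (w i))"
      by (rule prod.reindex_bij_witness[of _ "\<lambda>i. l + k - i" "\<lambda>j. l + k - j"]) (auto simp: K_def)
    finally show ?thesis .
  qed
  \<comment> \<open>The modulus is k + 1 and not k, so that it is positive also for the empty word.
    Windows whose starting times differ by a positive multiple of it are disjoint.\<close>
  have res: "AE s in M. (\<lambda>m. (\<Sum>j<m. Y (r + j * Suc k) s) / real m) \<longlonglongrightarrow> (\<Prod>i<k. p (w i))" for r
  proof (rule strong_law_unit_interval)
    have "disjoint_family (\<lambda>j. K (r + j * Suc k))"
      unfolding disjoint_family_on_def
    proof (intro ballI impI)
      fix i j :: nat assume "i \<noteq> j"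
      have "a * Suc k + k < b * Suc k" if "a < b" for a b :: nat
        using mult_le_mono1[of "Suc a" b "Suc k"] that by simp
      then show "K (r + i * Suc k) \<inter> K (r + j * Suc k) = {}"
        using \<open>i \<noteq> j\<close> unfolding K_def by (cases i j rule: linorder_cases) fastforce+
    qed
    then have "indep_vars (\<lambda>j. Pi\<^sub>M (K (r + j * Suc k)) (\<lambda>_. count_space I))
        (\<lambda>j s. \<lambda>i\<in>K (r + j * Suc k). \<alpha> i s) UNIV"
      by (intro indep_vars_restrict[OF indep]) (auto simp: K_def)
    then show "indep_vars (\<lambda>_. borel) (\<lambda>j. Y (r + j * Suc k)) UNIV"
      unfolding Y_h by (rule indep_vars_compose2) simp
  next
    show "\<And>j. expectation (Y (r + j * Suc k)) = (\<Prod>i<k. p (w i))" by (rule mean)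
  next
    show "\<And>j s. Y (r + j * Suc k) s \<in> {0..1}" unfolding Y_def of_bool_def by (simp split: if_split)
  qed
  have "AE s in M. \<forall>r. (\<lambda>m. (\<Sum>j<m. Y (r + j * Suc k) s) / real m) \<longlonglongrightarrow> (\<Prod>i<k. p (w i))"
    unfolding AE_all_countable using res by blast
  then show ?thesis
  proof eventually_elim
    case (elim s)
    have "(\<lambda>n. (\<Sum>l<n. Y l s) / real n) \<longlonglongrightarrow> (\<Prod>i<k. p (w i))"
      by (rule average_residue_classes[of "Suc k"]) (use elim in blast)+
    then show ?case by (simp add: Y_def sum.atLeast1_atMost_eq)
  qed
qed

section \<open>Borel sets of a metric space, and maps from products of discrete spaces\<close>

lemma space_metric_borel [simp]: "space (metric_borel Y d) = Y"
  unfolding metric_borel_def by (simp add: space_measure_of_conv)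

lemma (in Metric_space) sets_metric_borel:
  "sets (metric_borel M d) = sigma_sets M {U. openin mtopology U}"
  unfolding metric_borel_def by (rule sets_measure_of) (use openin_subset in fastforce)

lemma (in Metric_space) measurable_metric_borelI:
  assumes "f \<in> space K \<rightarrow> M"
    and "\<And>U. openin mtopology U \<Longrightarrow> f -` U \<inter> space K \<in> sets K"
  shows "f \<in> measurable K (metric_borel M d)"
  using assms by (intro measurable_sigma_sets[OF sets_metric_borel]) (use openin_subset in fastforce)+

lemma (in Metric_space) continuous_map_measurable_metric_borel:
  assumes "continuous_map mtopology euclidean f"
  shows "f \<in> borel_measurable (metric_borel M d)"
proof (rule borel_measurableI)
  fix S :: "'b set" assume "open S"
  then have "openin mtopology {x \<in> topspace mtopology. f x \<in> S}"
    using assms by (intro openin_continuous_map_preimage) auto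
  then have "{x \<in> M. f x \<in> S} \<in> sets (metric_borel M d)"
    unfolding sets_metric_borel by (intro sigma_sets.Basic) simp
  moreover have "f -` S \<inter> M = {x \<in> M. f x \<in> S}" by auto
  ultimately show "f -` S \<inter> space (metric_borel M d) \<in> sets (metric_borel M d)" by simp
qed

text \<open>A basic neighbourhood in a product of discrete spaces may fix finitely many coordinates
  and leave the others free, so \<open>local_const\<close> is continuity at each point.\<close>

lemma (in Metric_space) continuous_map_from_discrete_product:
  assumes into: "\<And>s. s \<in> PiE J F \<Longrightarrow> f s \<in> M"
    and local_const: "\<And>s e. s \<in> PiE J F \<Longrightarrow> e > 0 \<Longrightarrow>
      \<exists>K. finite K \<and> K \<subseteq> J \<and> (\<forall>t\<in>PiE J F. (\<forall>i\<in>K. t i = s i) \<longrightarrow> d (f s) (f t) < e)"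
  shows "continuous_map (product_topology (\<lambda>i. discrete_topology (F i)) J) mtopology f"
  unfolding continuous_map_def
proof (intro conjI allI impI)
  fix U assume U: "openin mtopology U"
  show "openin (product_topology (\<lambda>i. discrete_topology (F i)) J)
      {s \<in> topspace (product_topology (\<lambda>i. discrete_topology (F i)) J). f s \<in> U}"
    unfolding openin_product_topology_alt
  proof (clarsimp, goal_cases)
    case (1 s)
    with U obtain e where e: "e > 0" "mball (f s) e \<subseteq> U" unfolding openin_mtopology by blast
    from local_const[OF 1(1) e(1)] obtain K where K: "finite K" "K \<subseteq> J"
      "\<And>t. t \<in> PiE J F \<Longrightarrow> (\<forall>i\<in>K. t i = s i) \<Longrightarrow> d (f s) (f t) < e" by blast
    \<comment> \<open>The box \<open>PiE J W\<close> fixes the coordinates in \<open>K\<close> to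
      those of \<open>s\<close>; it is the basic open neighbourhood of \<open>s\<close> that
      \<open>f\<close> maps into the ball.\<close>
    define W where "W = (\<lambda>i. if i \<in> K then {s i} else F i)"
    have W_F: "W i \<subseteq> F i" if "i \<in> J" for i using 1(1) that by (auto simp: W_def PiE_iff)
    have W_sub: "PiE J W \<subseteq> PiE J F" using W_F by (rule PiE_mono)
    have "finite {i \<in> J. W i \<noteq> F i}"
      by (rule finite_subset[OF _ K(1)]) (auto simp: W_def split: if_splits)
    moreover have "s \<in> PiE J W" using 1(1) by (auto simp: W_def PiE_iff)
    moreover have "t \<in> PiE J F \<and> f t \<in> U" if t: "t \<in> PiE J W" for t
    proof
      show tF: "t \<in> PiE J F" using t W_sub by blast
      have "\<forall>i\<in>K. t i = s i"
      proof
        fix i assume "i \<in> K"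
        then have "t i \<in> W i" using t K(2) by (auto simp: PiE_iff)
        with \<open>i \<in> K\<close> show "t i = s i" by (simp add: W_def)
      qed
      with K(3)[OF tF] show "f t \<in> U" using e(2) into[OF 1(1)] into[OF tF] by auto
    qed
    ultimately show ?case using W_F by (intro exI[of _ W]) auto
  qed
qed (use into in auto)

text \<open>Tychonoff's theorem for finite discrete factors, followed by a continuous image. It
  yields compactness of the space of code trees and of the set of coded groves.\<close>

lemma (in Metric_space) compactin_image_discrete_product:
  assumes "\<And>s. s \<in> PiE J F \<Longrightarrow> f s \<in> M"
    and "\<And>s e. s \<in> PiE J F \<Longrightarrow> e > 0 \<Longrightarrow>
      \<exists>K. finite K \<and> K \<subseteq> J \<and> (\<forall>t\<in>PiE J F. (\<forall>i\<in>K. t i = s i) \<longrightarrow> d (f s) (f t) < e)"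
    and "\<And>i. i \<in> J \<Longrightarrow> finite (F i)"
  shows "compactin mtopology (f ` PiE J F)"
proof -
  have "compact_space (product_topology (\<lambda>i. discrete_topology (F i)) J)"
    unfolding compact_space_product_topology
    using assms(3) by (simp add: compact_space_discrete_topology)
  then have "compactin mtopology (f ` topspace (product_topology (\<lambda>i. discrete_topology (F i)) J))"
    unfolding compact_space_def
    by (rule image_compactin) (rule continuous_map_from_discrete_product[OF assms(1,2)])
  then show ?thesis by simp
qed

section \<open>The metric spaces of code trees and groves\<close>

locale code_tree_ifs =
  fixes M N V :: nat
  assumes M_ge: "M \<ge> 2" and N_ge: "N \<ge> 1" and V_ge: "V \<ge> 1"
begin

abbreviation "\<Omega> \<equiv> code_trees M N"
abbreviation "G \<equiv> groves M N V"
abbreviation "I \<equiv> grove_indices M N V"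
abbreviation "\<eta> \<equiv> grove_map M V"

text \<open>Agreement on the levels below \<open>k\<close>. By \<open>tree_dist_le_iff\<close> this
  means distance at most M^(-k), so topological arguments can be made on labels.\<close>

definition tree_agree :: "nat \<Rightarrow> code_tree \<Rightarrow> code_tree \<Rightarrow> bool" where
  "tree_agree k \<omega> \<kappa> \<longleftrightarrow> (\<forall>i\<in>lists {1..M}. length i < k \<longrightarrow> \<omega> i = \<kappa> i)"

definition grove_agree :: "nat \<Rightarrow> grove \<Rightarrow> grove \<Rightarrow> bool" where
  "grove_agree k x y \<longleftrightarrow> (\<forall>v\<in>{1..V}. tree_agree k (x v) (y v))"

lemma grove_component: "x \<in> G \<Longrightarrow> v \<in> {1..V} \<Longrightarrow> x v \<in> \<Omega>"
  by (auto simp: groves_def)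

text \<open>Different code trees differ at some word, since both are \<open>undefined\<close> off
  the words. Hence the \<open>LEAST\<close> in the distance is attained: \<open>k\<close> is the
  first level of disagreement and \<open>i\<close> a word there.\<close>

lemma tree_dist_neq:
  assumes "\<omega> \<in> \<Omega>" "\<kappa> \<in> \<Omega>" "\<omega> \<noteq> \<kappa>"
  obtains k i where "tree_dist M \<omega> \<kappa> = 1 / real M ^ k" "tree_agree k \<omega> \<kappa>"
    "i \<in> lists {1..M}" "length i = k" "\<omega> i \<noteq> \<kappa> i"
proof -
  define Q where "Q = (\<lambda>k. \<exists>i\<in>lists {1..M}. length i = k \<and> \<omega> i \<noteq> \<kappa> i)"
  from assms obtain i where "i \<in> lists {1..M}" "\<omega> i \<noteq> \<kappa> i"
    unfolding code_trees_def by (meson PiE_ext)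
  then have "Q (length i)" unfolding Q_def by blast
  then have "Q (LEAST k. Q k)" by (rule LeastI)
  moreover have "tree_agree (LEAST k. Q k) \<omega> \<kappa>"
    using not_less_Least[of _ Q] unfolding tree_agree_def Q_def by blast
  moreover have "tree_dist M \<omega> \<kappa> = 1 / real M ^ (LEAST k. Q k)"
    using assms(3) by (simp add: tree_dist_def Q_def)
  ultimately show ?thesis using that unfolding Q_def by blast
qed

text \<open>If the first disagreement is at level \<open>l\<close>, the trees agree below
  \<open>k\<close> exactly when k <= l, and M > 1 turns this into a comparison of powers.\<close>

lemma tree_dist_le_iff:
  assumes "\<omega> \<in> \<Omega>" "\<kappa> \<in> \<Omega>"
  shows "tree_dist M \<omega> \<kappa> \<le> 1 / real M ^ k \<longleftrightarrow> tree_agree k \<omega> \<kappa>"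
proof (cases "\<omega> = \<kappa>")
  case True
  then show ?thesis by (simp add: tree_dist_def tree_agree_def)
next
  case False
  from tree_dist_neq[OF assms False] obtain l i
    where l: "tree_dist M \<omega> \<kappa> = 1 / real M ^ l" "tree_agree l \<omega> \<kappa>"
      "i \<in> lists {1..M}" "length i = l" "\<omega> i \<noteq> \<kappa> i" .
  have "1 / real M ^ l \<le> 1 / real M ^ k \<longleftrightarrow> real M ^ k \<le> real M ^ l"
    using M_ge by (simp add: field_simps)
  also have "\<dots> \<longleftrightarrow> k \<le> l"
    using M_ge by (intro power_increasing_iff) simp
  also have "\<dots> \<longleftrightarrow> tree_agree k \<omega> \<kappa>"
    using l unfolding tree_agree_def by (meson le_less_trans not_less less_le_trans)
  finally show ?thesis using l by simp
qed

lemma tree_metric: "Metric_space \<Omega> (tree_dist M)"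
proof
  show "0 \<le> tree_dist M x y" for x y by (simp add: tree_dist_def)
  show "tree_dist M x y = tree_dist M y x" for x y
    unfolding tree_dist_def by (simp only: eq_commute[of y] eq_commute[of "y i" for i])
  show "tree_dist M x y = 0 \<longleftrightarrow> x = y" for x y using M_ge by (simp add: tree_dist_def)
  fix x y z assume xyz: "x \<in> \<Omega>" "y \<in> \<Omega>" "z \<in> \<Omega>"
  have nonneg: "0 \<le> tree_dist M x y" "0 \<le> tree_dist M y z" by (simp_all add: tree_dist_def)
  show "tree_dist M x z \<le> tree_dist M x y + tree_dist M y z"
  proof (cases "x = z")
    case True
    then show ?thesis using nonneg by (simp add: tree_dist_def)
  next
    case False
    from tree_dist_neq[OF xyz(1,3) False] obtain l i
      where l: "tree_dist M x z = 1 / real M ^ l" "i \<in> lists {1..M}" "length i = l" "x i \<noteq> z i" .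
    \<comment> \<open>Trees that differ at a word of length \<open>l\<close> are at distance at
      least M^(-l). Since \<open>x\<close> and \<open>z\<close> differ at \<open>i\<close>, the tree
      \<open>y\<close> differs there from one of them, which gives the triangle inequality.\<close>
    have lower: "1 / real M ^ l \<le> tree_dist M u w"
      if uw: "u \<in> \<Omega>" "w \<in> \<Omega>" and ne: "u i \<noteq> w i" for u w
    proof -
      from ne have "u \<noteq> w" by auto
      from tree_dist_neq[OF uw this] obtain m where
        m: "tree_dist M u w = 1 / real M ^ m" "tree_agree m u w" by metis
      have "m \<le> l" using m(2) l ne unfolding tree_agree_def by (metis not_less)
      then show ?thesis using M_ge unfolding m(1) by (simp add: field_simps power_increasing)
    qed
    show ?thesis
    proof (cases "x i = y i")
      case True
      then show ?thesis using lower[OF xyz(2,3)] l nonneg by simp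
    next
      case False
      then show ?thesis using lower[OF xyz(1,2)] l nonneg by simp
    qed
  qed
qed

sublocale tree: Metric_space \<Omega> "tree_dist M"
  by (rule tree_metric)

lemma grove_dist_le:
  "grove_dist M V x y \<le> e \<longleftrightarrow> (\<forall>v\<in>{1..V}. tree_dist M (x v) (y v) \<le> e)"
  unfolding grove_dist_def using V_ge by (subst Max_le_iff) auto

lemma tree_dist_le_grove_dist:
  "v \<in> {1..V} \<Longrightarrow> tree_dist M (x v) (y v) \<le> grove_dist M V x y"
  using grove_dist_le by blast

lemma grove_dist_le_iff:
  assumes "x \<in> G" "y \<in> G"
  shows "grove_dist M V x y \<le> 1 / real M ^ k \<longleftrightarrow> grove_agree k x y"
  unfolding grove_dist_le grove_agree_def
  using assms by (simp add: tree_dist_le_iff grove_component)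

lemma grove_metric: "Metric_space G (grove_dist M V)"
proof
  have V1: "1 \<in> {1..V}" using V_ge by simp
  show nonneg: "0 \<le> grove_dist M V x y" for x y
    using tree_dist_le_grove_dist[OF V1, of x y] tree.nonneg[of "x 1" "y 1"] by linarith
  show "grove_dist M V x y = grove_dist M V y x" for x y
    unfolding grove_dist_def by (simp add: tree.commute)
  fix x y assume xy: "x \<in> G" "y \<in> G"
  show "grove_dist M V x y = 0 \<longleftrightarrow> x = y"
  proof
    assume "grove_dist M V x y = 0"
    then have "tree_dist M (x v) (y v) \<le> 0" if "v \<in> {1..V}" for v
      using tree_dist_le_grove_dist[OF that, of x y] by simp
    then have "x v = y v" if "v \<in> {1..V}" for v
      using that xy tree.zero tree.nonneg by (metis grove_component order_antisym)
    then show "x = y" using xy unfolding groves_def by (meson PiE_ext)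
  next
    assume "x = y"
    then have "grove_dist M V x y \<le> 0" by (simp add: grove_dist_le tree_dist_def)
    with nonneg[of x y] show "grove_dist M V x y = 0" by simp
  qed
next
  fix x y z assume xyz: "x \<in> G" "y \<in> G" "z \<in> G"
  show "grove_dist M V x z \<le> grove_dist M V x y + grove_dist M V y z"
    unfolding grove_dist_le
  proof
    fix v assume v: "v \<in> {1..V}"
    have "tree_dist M (x v) (z v) \<le> tree_dist M (x v) (y v) + tree_dist M (y v) (z v)"
      using xyz v by (intro tree.triangle grove_component)
    then show "tree_dist M (x v) (z v) \<le> grove_dist M V x y + grove_dist M V y z"
      using tree_dist_le_grove_dist[OF v, of x y] tree_dist_le_grove_dist[OF v, of y z] by linarith
  qed
qed

sublocale grove: Metric_space G "grove_dist M V"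
  by (rule grove_metric)

lemma ex_small_radius:
  assumes "e > 0" obtains k where "1 / real M ^ k < e"
proof -
  have "1 / real M < 1" using M_ge by simp
  from real_arch_pow_inv[OF assms this] obtain k where "(1 / real M) ^ k < e" ..
  then show ?thesis using that by (simp add: power_divide)
qed

text \<open>The sets of groves agreeing with \<open>x\<close> below level \<open>k\<close> are the
  closed balls of radius M^(-k), and these radii tend to 0, so they serve as a neighbourhood
  base.\<close>

lemma openin_grove_iff:
  "openin grove.mtopology U \<longleftrightarrow>
     U \<subseteq> G \<and> (\<forall>x\<in>U. \<exists>k. \<forall>y\<in>G. grove_agree k x y \<longrightarrow> y \<in> U)"
proof -
  have "(\<exists>e>0. grove.mball x e \<subseteq> U) \<longleftrightarrow> (\<exists>k. \<forall>y\<in>G. grove_agree k x y \<longrightarrow> y \<in> U)"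
    if x: "x \<in> G" for x
  proof
    assume "\<exists>e>0. grove.mball x e \<subseteq> U"
    then obtain e where e: "e > 0" "grove.mball x e \<subseteq> U" by blast
    obtain k where "1 / real M ^ k < e" using ex_small_radius[OF e(1)] .
    then show "\<exists>k. \<forall>y\<in>G. grove_agree k x y \<longrightarrow> y \<in> U"
      using e(2) x grove_dist_le_iff[OF x, of _ k] by (intro exI[of _ k]) force
  next
    assume "\<exists>k. \<forall>y\<in>G. grove_agree k x y \<longrightarrow> y \<in> U"
    then obtain k where "\<forall>y\<in>G. grove_agree k x y \<longrightarrow> y \<in> U" ..
    then have "grove.mball x (1 / real M ^ k) \<subseteq> U"
      using grove_dist_le_iff[OF x, of _ k] by (meson grove.in_mball less_imp_le subsetI)
    moreover have "1 / real M ^ k > 0" using M_ge by simp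
    ultimately show "\<exists>e>0. grove.mball x e \<subseteq> U" by blast
  qed
  then show ?thesis unfolding grove.openin_mtopology by blast
qed

lemma grove_agree_trans: "grove_agree k x y \<Longrightarrow> grove_agree k y z \<Longrightarrow> grove_agree k x z"
  by (simp add: grove_agree_def tree_agree_def)

lemma grove_agree_antimono: "grove_agree l x y \<Longrightarrow> k \<le> l \<Longrightarrow> grove_agree k x y"
  by (simp add: grove_agree_def tree_agree_def)

lemma grove_eqI:
  assumes "x \<in> G" "y \<in> G" "\<And>k. grove_agree k x y"
  shows "x = y"
proof -
  have "x v i = y v i" if "v \<in> {1..V}" "i \<in> lists {1..M}" for v i
    using assms(3)[of "Suc (length i)"] that by (auto simp: grove_agree_def tree_agree_def)
  then have "x v = y v" if "v \<in> {1..V}" for v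
    using that grove_component[OF assms(1) that] grove_component[OF assms(2) that]
    unfolding code_trees_def by (meson PiE_ext)
  then show ?thesis using assms(1,2) unfolding groves_def by (meson PiE_ext)
qed

text \<open>Code trees form a product of finite discrete spaces. The identity from it to the metric
  topology is continuous, because the labels at finitely many short words bound the
  distance.\<close>

lemma tree_compact: "compact_space tree.mtopology"
proof -
  have "compactin tree.mtopology ((\<lambda>\<omega>. \<omega>) ` (lists {1..M} \<rightarrow>\<^sub>E {1..N}))"
  proof (rule tree.compactin_image_discrete_product)
    fix \<omega> :: code_tree and e :: real
    assume \<omega>: "\<omega> \<in> lists {1..M} \<rightarrow>\<^sub>E {1..N}" and "e > 0"
    obtain k where k: "1 / real M ^ k < e" using ex_small_radius[OF \<open>e > 0\<close>] .
    define K where "K = {i. set i \<subseteq> {1..M} \<and> length i \<le> k}"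
    have "tree_dist M \<omega> \<kappa> < e" if "\<kappa> \<in> lists {1..M} \<rightarrow>\<^sub>E {1..N}" "\<forall>i\<in>K. \<kappa> i = \<omega> i" for \<kappa>
    proof -
      have "tree_agree k \<omega> \<kappa>" using that(2) by (auto simp: tree_agree_def K_def in_lists_conv_set)
      then show ?thesis using k tree_dist_le_iff[of \<omega> \<kappa> k] \<omega> that(1) by (simp add: code_trees_def)
    qed
    moreover have "finite K" unfolding K_def by (rule finite_lists_length_le) simp
    ultimately show "\<exists>K. finite K \<and> K \<subseteq> lists {1..M} \<and>
        (\<forall>\<kappa>\<in>lists {1..M} \<rightarrow>\<^sub>E {1..N}. (\<forall>i\<in>K. \<kappa> i = \<omega> i) \<longrightarrow> tree_dist M \<omega> \<kappa> < e)"
      by (intro exI[of _ K]) (auto simp: K_def)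
  qed (auto simp: code_trees_def)
  then have "compactin tree.mtopology \<Omega>" unfolding image_ident code_trees_def[symmetric] .
  then show ?thesis unfolding compact_space_def tree.topspace_mtopology .
qed

text \<open>The Heine-Cantor theorem on the compact space of code trees, with the modulus of
  continuity expressed as a level.\<close>

lemma tree_uniform_continuity:
  fixes f :: "code_tree \<Rightarrow> real"
  assumes "continuous_map tree.mtopology euclideanreal f" "e > 0"
  obtains k where "\<And>\<omega> \<kappa>. \<omega> \<in> \<Omega> \<Longrightarrow> \<kappa> \<in> \<Omega> \<Longrightarrow> tree_agree k \<omega> \<kappa> \<Longrightarrow> \<bar>f \<omega> - f \<kappa>\<bar> < e"
proof -
  have "uniformly_continuous_map (metric (\<Omega>, tree_dist M)) (euclidean_metric :: real metric) f"
  proof (intro continuous_imp_uniformly_continuous_map conjI)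
    show "compact_space (mtopology_of (metric (\<Omega>, tree_dist M)))"
      unfolding tree.mtopology_of by (rule tree_compact)
    show "continuous_map (mtopology_of (metric (\<Omega>, tree_dist M))) (mtopology_of euclidean_metric) f"
      unfolding tree.mtopology_of mtopology_of_euclidean by (rule assms(1))
  qed
  then have "\<forall>e>0. \<exists>d>0. \<forall>x\<in>\<Omega>. \<forall>y\<in>\<Omega>. tree_dist M y x < d \<longrightarrow> dist (f y) (f x) < e"
    unfolding uniformly_continuous_map_def tree.mspace_metric tree.mdist_metric mdist_euclidean_metric by (rule conjunct2)
  with \<open>e > 0\<close> have "\<exists>d>0. \<forall>x\<in>\<Omega>. \<forall>y\<in>\<Omega>. tree_dist M y x < d \<longrightarrow> dist (f y) (f x) < e"
    by blast
  then obtain d where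
    d: "d > 0" "\<And>x y. x \<in> \<Omega> \<Longrightarrow> y \<in> \<Omega> \<Longrightarrow> tree_dist M y x < d \<Longrightarrow> dist (f y) (f x) < e"
    by blast
  obtain k where k: "1 / real M ^ k < d" using ex_small_radius[OF d(1)] .
  show ?thesis
  proof (rule that)
    fix \<omega> \<kappa> assume a: "\<omega> \<in> \<Omega>" "\<kappa> \<in> \<Omega>" "tree_agree k \<omega> \<kappa>"
    then show "\<bar>f \<omega> - f \<kappa>\<bar> < e"
      using d(2)[of \<kappa> \<omega>] k tree_dist_le_iff[of \<omega> \<kappa> k] by (simp add: dist_real_def)
  qed
qed
end

section \<open>Coding and the set attractor\<close>

text \<open>The limit grove is given by recursion on the word, with no limit taken. Reading a letter
  \<open>m\<close> moves from position \<open>v\<close> to the position that \<open>s 0\<close>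
  prescribes for the m-th subtree, and shifts \<open>s\<close>; hence a word of length
  \<open>n\<close> consults only \<open>s 0\<close>, ..., \<open>s n\<close>.\<close>

fun coded_label :: "(nat \<Rightarrow> grove_index) \<Rightarrow> nat \<Rightarrow> nat list \<Rightarrow> nat" where
  "coded_label s v [] = fst (s 0 v)"
| "coded_label s v (m # j) = coded_label (\<lambda>i. s (Suc i)) (snd (s 0 v) m) j"

context code_tree_ifs
begin

definition coded_grove :: "(nat \<Rightarrow> grove_index) \<Rightarrow> grove" where
  "coded_grove s = (\<lambda>v\<in>{1..V}. \<lambda>i\<in>lists {1..M}. coded_label s v i)"

lemma grove_index_fst: "a \<in> I \<Longrightarrow> v \<in> {1..V} \<Longrightarrow> fst (a v) \<in> {1..N}"
  unfolding grove_indices_def by (auto dest!: PiE_mem)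

lemma grove_index_snd: "a \<in> I \<Longrightarrow> v \<in> {1..V} \<Longrightarrow> m \<in> {1..M} \<Longrightarrow> snd (a v) m \<in> {1..V}"
  unfolding grove_indices_def by (auto dest!: PiE_mem simp: mem_Times_iff)

lemma finite_grove_indices: "finite I"
  unfolding grove_indices_def by (intro finite_PiE finite_cartesian_product) auto

lemma coded_label_range:
  assumes "\<And>l. s l \<in> I" "v \<in> {1..V}" "i \<in> lists {1..M}"
  shows "coded_label s v i \<in> {1..N}"
  using assms
proof (induction i arbitrary: s v)
  case Nil
  then show ?case using grove_index_fst by simp
next
  case (Cons m j)
  have "coded_label (\<lambda>i. s (Suc i)) (snd (s 0 v) m) j \<in> {1..N}"
    using Cons.prems by (intro Cons.IH grove_index_snd) auto
  then show ?case by simp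
qed

lemma coded_grove_in:
  assumes "\<And>l. s l \<in> I"
  shows "coded_grove s \<in> G"
  unfolding coded_grove_def groves_def code_trees_def
  by (intro restrict_PiE_iff[THEN iffD2] ballI coded_label_range assms)

lemma grove_map_Nil: "v \<in> {1..V} \<Longrightarrow> \<eta> a x v [] = fst (a v)"
  by (simp add: grove_map_def tree_join_def)

lemma grove_map_Cons:
  "v \<in> {1..V} \<Longrightarrow> m # j \<in> lists {1..M} \<Longrightarrow> \<eta> a x v (m # j) = x (snd (a v) m) j"
  by (simp add: grove_map_def tree_join_def)

lemma grove_map_in:
  assumes "a \<in> I" "x \<in> G"
  shows "\<eta> a x \<in> G"
proof -
  have "\<eta> a x v i \<in> {1..N}" if v: "v \<in> {1..V}" and i: "i \<in> lists {1..M}" for v i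
  proof (cases i)
    case Nil
    then show ?thesis using grove_index_fst[OF assms(1) v] by (simp add: grove_map_Nil[OF v])
  next
    case (Cons m j)
    then have m: "m \<in> {1..M}" and j: "j \<in> lists {1..M}" using i by auto
    have "x (snd (a v) m) \<in> \<Omega>"
      by (intro grove_component assms(2) grove_index_snd assms(1) v m)
    then have "x (snd (a v) m) j \<in> {1..N}" using j unfolding code_trees_def by (rule PiE_mem)
    then show ?thesis using grove_map_Cons[OF v] i Cons by simp
  qed
  moreover have "\<eta> a x \<in> extensional {1..V}" by (simp add: grove_map_def)
  moreover have "\<eta> a x v \<in> extensional (lists {1..M})" if "v \<in> {1..V}" for v
    using that by (simp add: grove_map_def tree_join_def)
  ultimately show ?thesis unfolding groves_def code_trees_def PiE_def Pi_def by blast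
qed

text \<open>\<open>\<eta> a\<close> moves the old trees one level down, below new roots labelled by
  \<open>a\<close> alone. Gaining one level of agreement is contraction by the factor 1/M.\<close>

lemma grove_map_agree:
  assumes "a \<in> I" "grove_agree k x y"
  shows "grove_agree (Suc k) (\<eta> a x) (\<eta> a y)"
  unfolding grove_agree_def tree_agree_def
proof (intro ballI impI)
  fix v i assume v: "v \<in> {1..V}" and i: "i \<in> lists {1..M}" and len: "length i < Suc k"
  show "\<eta> a x v i = \<eta> a y v i"
  proof (cases i)
    case Nil
    then show ?thesis by (simp add: grove_map_Nil[OF v])
  next
    case (Cons m j)
    then have "m \<in> {1..M}" "j \<in> lists {1..M}" "length j < k" using i len by auto
    then have "x (snd (a v) m) j = y (snd (a v) m) j"
      using assms(2) grove_index_snd[OF assms(1) v] unfolding grove_agree_def tree_agree_def by blast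
    then show ?thesis using grove_map_Cons[OF v] i Cons by simp
  qed
qed

text \<open>The recursion of \<open>coded_label\<close> read as an identity of groves: removing the
  first index from the code corresponds to undoing one map.\<close>

lemma coded_grove_unfold:
  assumes "\<And>l. s l \<in> I"
  shows "coded_grove s = \<eta> (s 0) (coded_grove (\<lambda>l. s (Suc l)))"
proof (rule grove_eqI)
  show "coded_grove s \<in> G" using assms by (rule coded_grove_in)
  show "\<eta> (s 0) (coded_grove (\<lambda>l. s (Suc l))) \<in> G"
    using assms by (intro grove_map_in coded_grove_in)
  fix k
  have "coded_grove s v i = \<eta> (s 0) (coded_grove (\<lambda>l. s (Suc l))) v i"
    if v: "v \<in> {1..V}" and i: "i \<in> lists {1..M}" for v i
  proof (cases i)
    case Nil
    then show ?thesis using v by (simp add: grove_map_Nil[OF v] coded_grove_def)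
  next
    case (Cons m j)
    then have m: "m \<in> {1..M}" and j: "j \<in> lists {1..M}" using i by auto
    then show ?thesis
      using grove_map_Cons[OF v] i Cons v grove_index_snd[OF assms v m] by (simp add: coded_grove_def)
  qed
  then show "grove_agree k (coded_grove s) (\<eta> (s 0) (coded_grove (\<lambda>l. s (Suc l))))"
    by (simp add: grove_agree_def tree_agree_def)
qed

text \<open>Here \<open>y\<close> runs backwards along the maps, so \<open>y 0\<close> results from
  an arbitrary grove \<open>y k\<close> by \<open>k\<close> maps, each gaining one level. This
  serves fixed sets, where backward orbits are chosen, and random orbits, where time is
  reversed.\<close>

lemma orbit_agree_coded_grove:
  assumes "\<And>l. s l \<in> I" "\<And>l. l < k \<Longrightarrow> y l = \<eta> (s l) (y (Suc l))"
  shows "grove_agree k (y 0) (coded_grove s)"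
  using assms
proof (induction k arbitrary: s y)
  case 0
  then show ?case by (simp add: grove_agree_def tree_agree_def)
next
  case (Suc k)
  have "grove_agree k (y (Suc 0)) (coded_grove (\<lambda>l. s (Suc l)))"
    using Suc.prems by (intro Suc.IH[of "\<lambda>l. s (Suc l)" "\<lambda>l. y (Suc l)"]) auto
  then have "grove_agree (Suc k) (\<eta> (s 0) (y (Suc 0))) (\<eta> (s 0) (coded_grove (\<lambda>l. s (Suc l))))"
    by (intro grove_map_agree Suc.prems)
  then show ?case using coded_grove_unfold[of s] Suc.prems by simp
qed

lemma coded_grove_agree:
  assumes "\<And>l. s l \<in> I" "\<And>l. t l \<in> I" "\<And>l. l < k \<Longrightarrow> s l = t l"
  shows "grove_agree k (coded_grove s) (coded_grove t)"
proof -
  have "grove_agree k (coded_grove (\<lambda>l. s (0 + l))) (coded_grove t)"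
  \<comment> \<open>The shifts of \<open>s\<close> have coded groves forming such an orbit, and its
    first \<open>k\<close> maps are those of \<open>t\<close>.\<close>
  proof (rule orbit_agree_coded_grove[of t k "\<lambda>n. coded_grove (\<lambda>l. s (n + l))"])
    fix l assume "l < k"
    then show "coded_grove (\<lambda>i. s (l + i)) = \<eta> (t l) (coded_grove (\<lambda>i. s (Suc l + i)))"
      using coded_grove_unfold[of "\<lambda>i. s (l + i)"] assms by simp
  qed (rule assms)
  then show ?thesis by simp
qed

definition coded_groves :: "grove set" where
  "coded_groves = coded_grove ` (UNIV \<rightarrow>\<^sub>E I)"

lemma coded_grovesE:
  assumes "x \<in> coded_groves"
  obtains s where "\<And>l. s l \<in> I" "x = coded_grove s"
proof -
  from assms obtain s where "s \<in> UNIV \<rightarrow>\<^sub>E I" "x = coded_grove s"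
    unfolding coded_groves_def by blast
  then show ?thesis by (intro that[of s]) (auto dest: PiE_mem)
qed

lemma grove_index_exists: "I \<noteq> {}"
proof -
  have "(\<lambda>v\<in>{1..V}. (1, \<lambda>m\<in>{1..M}. 1)) \<in> I"
    unfolding grove_indices_def using N_ge V_ge by auto
  then show ?thesis by blast
qed

lemma coded_groves_compact: "compactin grove.mtopology coded_groves"
  unfolding coded_groves_def
proof (rule grove.compactin_image_discrete_product)
  fix s :: "nat \<Rightarrow> grove_index" and e :: real assume s: "s \<in> UNIV \<rightarrow>\<^sub>E I" and "e > 0"
  obtain k where k: "1 / real M ^ k < e" using ex_small_radius[OF \<open>e > 0\<close>] .
  have "grove_dist M V (coded_grove s) (coded_grove t) < e"
    if t: "t \<in> UNIV \<rightarrow>\<^sub>E I" and eq: "\<forall>i\<in>{..<k}. t i = s i" for t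
  proof -
    have "grove_agree k (coded_grove s) (coded_grove t)"
      using s t eq by (intro coded_grove_agree) (auto simp: PiE_iff)
    then have "grove_dist M V (coded_grove s) (coded_grove t) \<le> 1 / real M ^ k"
      using s t by (subst grove_dist_le_iff) (auto simp: PiE_iff intro!: coded_grove_in)
    with k show ?thesis by simp
  qed
  then show "\<exists>K. finite K \<and> K \<subseteq> UNIV \<and> (\<forall>t\<in>UNIV \<rightarrow>\<^sub>E I. (\<forall>i\<in>K. t i = s i) \<longrightarrow>
      grove_dist M V (coded_grove s) (coded_grove t) < e)"
    by (intro exI[of _ "{..<k}"]) auto
qed (auto simp: PiE_iff intro!: coded_grove_in finite_grove_indices)

lemma coded_groves_fixed: "coded_groves = (\<Union>a\<in>I. \<eta> a ` coded_groves)"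
proof (intro equalityI subsetI)
  fix x assume "x \<in> coded_groves"
  then obtain s where s: "\<And>l. s l \<in> I" "x = coded_grove s"
    by (rule coded_grovesE) blast
  have "x = \<eta> (s 0) (coded_grove (\<lambda>l. s (Suc l)))" unfolding s(2) by (intro coded_grove_unfold) (rule s(1))
  moreover have "coded_grove (\<lambda>l. s (Suc l)) \<in> coded_groves"
    unfolding coded_groves_def using s(1) by auto
  ultimately show "x \<in> (\<Union>a\<in>I. \<eta> a ` coded_groves)" using s(1) by blast
next
  fix x assume "x \<in> (\<Union>a\<in>I. \<eta> a ` coded_groves)"
  then obtain a y where a: "a \<in> I" "y \<in> coded_groves" "x = \<eta> a y" by blast
  from a(2) obtain s where s: "\<And>l. s l \<in> I" "y = coded_grove s"
    by (rule coded_grovesE) blast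
  \<comment> \<open>Prefixing \<open>a\<close> to the code of \<open>y\<close> gives a code of
    \<open>\<eta> a y\<close>.\<close>
  have "case_nat a s l \<in> I" for l using s a by (cases l) auto
  moreover from this have "x = coded_grove (case_nat a s)"
    by (subst coded_grove_unfold) (simp_all add: a s)
  ultimately show "x \<in> coded_groves" unfolding coded_groves_def by auto
qed

text \<open>Every point of \<open>B\<close> is the image of a point of \<open>B\<close> under some
  map. Iterating this choice gives a backward orbit inside \<open>B\<close>, and the indices chosen
  along it code the point at its start.\<close>

lemma fixed_subset_coded_groves:
  assumes sub: "B \<subseteq> G" and fixed: "B = (\<Union>a\<in>I. \<eta> a ` B)"
  shows "B \<subseteq> coded_groves"
proof
  fix x assume "x \<in> B"
  have "\<forall>x\<in>B. \<exists>ay. fst ay \<in> I \<and> snd ay \<in> B \<and> x = \<eta> (fst ay) (snd ay)"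
    using fixed by fastforce
  then obtain h where h: "\<And>x. x \<in> B \<Longrightarrow> fst (h x) \<in> I \<and> snd (h x) \<in> B \<and> x = \<eta> (fst (h x)) (snd (h x))"
    by metis
  \<comment> \<open>\<open>h\<close> selects an index and a preimage, \<open>y\<close> is the
    resulting backward orbit of \<open>x\<close>, and \<open>s\<close> records its indices.\<close>
  define y where "y = (\<lambda>n. ((\<lambda>x. snd (h x)) ^^ n) x)"
  define s where "s = (\<lambda>n. fst (h (y n)))"
  have y: "y n \<in> B" for n by (induction n) (use \<open>x \<in> B\<close> h in \<open>auto simp: y_def\<close>)
  have s: "s n \<in> I" for n using h[OF y] by (simp add: s_def)
  have step: "y n = \<eta> (s n) (y (Suc n))" for n
    using h[OF y, of n] by (simp add: s_def y_def)
  have "y 0 = coded_grove s"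
  proof (rule grove_eqI)
    show "y 0 \<in> G" using y sub by blast
    show "coded_grove s \<in> G" using s by (rule coded_grove_in)
    show "grove_agree k (y 0) (coded_grove s)" for k
      using s step by (rule orbit_agree_coded_grove)
  qed
  moreover have "y 0 = x" by (simp add: y_def)
  ultimately show "x \<in> coded_groves" unfolding coded_groves_def using s by auto
qed

text \<open>Applying the first \<open>k\<close> maps of a code, innermost last index first, to any
  point of \<open>B\<close> stays in \<open>B\<close> and agrees with the coded grove below level
  \<open>k\<close>. So coded groves are limits of points of \<open>B\<close>.\<close>

lemma coded_groves_subset_closed_fixed:
  assumes "closedin grove.mtopology B" "B \<noteq> {}" and fixed: "B = (\<Union>a\<in>I. \<eta> a ` B)"
  shows "coded_groves \<subseteq> B"
proof
  have approx: "\<exists>y\<in>B. grove_agree k (coded_grove s) y" if "\<And>l. s l \<in> I" for k s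
    using that
  proof (induction k arbitrary: s)
    case 0
    then show ?case using assms(2) by (auto simp: grove_agree_def tree_agree_def)
  next
    case (Suc k)
    have "\<exists>y\<in>B. grove_agree k (coded_grove (\<lambda>l. s (Suc l))) y"
      using Suc.prems by (intro Suc.IH)
    then obtain y where y: "y \<in> B" "grove_agree k (coded_grove (\<lambda>l. s (Suc l))) y" by blast
    have "grove_agree (Suc k) (coded_grove s) (\<eta> (s 0) y)"
      by (subst coded_grove_unfold[of s]) (intro Suc.prems grove_map_agree y)+
    moreover have "\<eta> (s 0) y \<in> B" using fixed y(1) Suc.prems by blast
    ultimately show ?case by blast
  qed
  fix x assume "x \<in> coded_groves"
  then obtain s where s: "\<And>l. s l \<in> I" "x = coded_grove s"
    by (rule coded_grovesE) blast
  show "x \<in> B"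
  proof (rule ccontr)
    assume "x \<notin> B"
    then have "x \<in> G - B" using s coded_grove_in by blast
    moreover have "openin grove.mtopology (G - B)"
      using assms(1) by (simp add: closedin_def)
    ultimately obtain k where k: "\<And>y. y \<in> G \<Longrightarrow> grove_agree k x y \<Longrightarrow> y \<in> G - B"
      unfolding openin_grove_iff by blast
    have "\<exists>y\<in>B. grove_agree k x y" unfolding s(2) by (rule approx) (rule s(1))
    then obtain y where "y \<in> B" "grove_agree k x y" by blast
    moreover have "B \<subseteq> G" using closedin_subset[OF assms(1)] by simp
    ultimately show False using k[of y] by blast
  qed
qed

text \<open>Uniqueness combines the two inclusions for fixed sets; a compact set is closed because
  the metric topology is Hausdorff.\<close>

lemma grove_attractor_eq: "grove_attractor M N V = coded_groves"
  unfolding grove_attractor_def set_attractor_def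
proof (rule the_equality)
  have "coded_groves \<noteq> {}"
    unfolding coded_groves_def using grove_index_exists by (simp add: PiE_eq_empty_iff)
  then show "coded_groves \<noteq> {} \<and> compactin grove.mtopology coded_groves \<and>
      coded_groves = (\<Union>a\<in>I. \<eta> a ` coded_groves)"
    using coded_groves_compact coded_groves_fixed by blast
next
  fix B assume B: "B \<noteq> {} \<and> compactin grove.mtopology B \<and> B = (\<Union>a\<in>I. \<eta> a ` B)"
  then have "closedin grove.mtopology B"
    using compactin_imp_closedin grove.Hausdorff_space_mtopology by blast
  moreover from this have "B \<subseteq> G" using closedin_subset by fastforce
  ultimately show "B = coded_groves"
    using B fixed_subset_coded_groves[of B] coded_groves_subset_closed_fixed[of B] by blast
qed

section \<open>Equality of the component sets\<close>

lemma component_trees_subset: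
  assumes "v \<in> {1..V}" "w \<in> {1..V}"
  shows "component_trees M N V v \<subseteq> component_trees M N V w"
proof
  fix \<omega> assume "\<omega> \<in> component_trees M N V v"
  then obtain x where x: "x \<in> coded_groves" "\<omega> = x v"
    unfolding component_trees_def grove_attractor_eq by blast
  then obtain a y where a: "a \<in> I" "y \<in> coded_groves" "x = \<eta> a y"
    using coded_groves_fixed by blast
  \<comment> \<open>The w-th tree of \<open>\<eta> b y\<close> depends on \<open>b\<close> only
    through \<open>b w\<close>, which is now \<open>a v\<close>.\<close>
  define b where "b = a(w := a v)"
  have "b \<in> I" unfolding b_def grove_indices_def
    using a(1) assms unfolding grove_indices_def by (auto simp: PiE_iff extensional_def)
  then have "\<eta> b y \<in> coded_groves" using a(2) coded_groves_fixed by blast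
  moreover have "\<eta> b y w = \<omega>" using assms a(3) x(2) by (simp add: grove_map_def b_def)
  ultimately show "\<omega> \<in> component_trees M N V w"
    unfolding component_trees_def grove_attractor_eq by blast
qed

lemma component_trees_eq:
  "v \<in> {1..V} \<Longrightarrow> component_trees M N V v = component_trees M N V 1"
  using V_ge by (intro equalityI component_trees_subset) auto

end

section \<open>The measure attractor\<close>

lemma sets_weighted_sum_measure [simp]: "sets (weighted_sum_measure B J p \<nu>) = sets B"
  unfolding weighted_sum_measure_def by (simp add: sets.space_closed sets.sigma_sets_eq)

lemma space_weighted_sum_measure [simp]: "space (weighted_sum_measure B J p \<nu>) = space B"
  unfolding weighted_sum_measure_def by (simp add: space_measure_of_conv)

text \<open>\<open>measure_of\<close> returns the given set function once countable additivity is
  known; here a finite sum is exchanged with a series.\<close>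

lemma emeasure_weighted_sum_measure:
  assumes "\<And>i. i \<in> J \<Longrightarrow> sets (\<nu> i) = sets B" "E \<in> sets B"
  shows "emeasure (weighted_sum_measure B J p \<nu>) E = (\<Sum>i\<in>J. ennreal (p i) * emeasure (\<nu> i) E)"
  unfolding weighted_sum_measure_def
proof (rule emeasure_measure_of_sigma)
  show "sigma_algebra (space B) (sets B)" by (rule sets.sigma_algebra_axioms)
  show "positive (sets B) (\<lambda>E. \<Sum>i\<in>J. ennreal (p i) * emeasure (\<nu> i) E)"
    by (simp add: positive_def)
  show "countably_additive (sets B) (\<lambda>E. \<Sum>i\<in>J. ennreal (p i) * emeasure (\<nu> i) E)"
  proof (rule countably_additiveI)
    fix A :: "nat \<Rightarrow> 'b set"
    assume A: "range A \<subseteq> sets B" "disjoint_family A"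
    have "(\<Sum>n. \<Sum>i\<in>J. ennreal (p i) * emeasure (\<nu> i) (A n)) =
        (\<Sum>i\<in>J. \<Sum>n. ennreal (p i) * emeasure (\<nu> i) (A n))"
      by (rule suminf_sum) simp
    also have "\<dots> = (\<Sum>i\<in>J. ennreal (p i) * emeasure (\<nu> i) (\<Union>n. A n))"
    proof (intro sum.cong refl)
      fix i assume "i \<in> J"
      then have "range A \<subseteq> sets (\<nu> i)" using A(1) assms(1) by simp
      then have "(\<Sum>n. emeasure (\<nu> i) (A n)) = emeasure (\<nu> i) (\<Union>n. A n)"
        using A(2) by (rule suminf_emeasure)
      then show "(\<Sum>n. ennreal (p i) * emeasure (\<nu> i) (A n)) = ennreal (p i) * emeasure (\<nu> i) (\<Union>n. A n)"
        by simp
    qed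
    finally show "(\<Sum>n. \<Sum>i\<in>J. ennreal (p i) * emeasure (\<nu> i) (A n)) =
        (\<Sum>i\<in>J. ennreal (p i) * emeasure (\<nu> i) (\<Union>n. A n))" .
  qed
qed (rule assms(2))

section \<open>Measurable maps of groves and a generator of the Borel sets\<close>

context code_tree_ifs
begin

abbreviation "GB \<equiv> metric_borel G (grove_dist M V)"

text \<open>A map preserving agreement at every level is continuous, so preimages of open sets are
  open.\<close>

lemma grove_measurableI:
  assumes "f \<in> G \<rightarrow> G" "\<And>k x y. x \<in> G \<Longrightarrow> y \<in> G \<Longrightarrow> grove_agree k x y \<Longrightarrow> grove_agree k (f x) (f y)"
  shows "f \<in> measurable GB GB"
proof (rule grove.measurable_metric_borelI)
  fix U assume "openin grove.mtopology U"
  then have U: "U \<subseteq> G" "\<And>x. x \<in> U \<Longrightarrow> \<exists>k. \<forall>y\<in>G. grove_agree k x y \<longrightarrow> y \<in> U"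
    unfolding openin_grove_iff by auto
  have "openin grove.mtopology (f -` U \<inter> G)"
    unfolding openin_grove_iff
  proof (intro conjI ballI)
    fix x assume x: "x \<in> f -` U \<inter> G"
    then obtain k where "\<And>y. y \<in> G \<Longrightarrow> grove_agree k (f x) y \<Longrightarrow> y \<in> U" using U(2) by blast
    then show "\<exists>k. \<forall>y\<in>G. grove_agree k x y \<longrightarrow> y \<in> f -` U \<inter> G"
      using x assms(1) assms(2)[of x _ k] by (intro exI[of _ k]) (auto simp: Pi_iff)
  qed simp
  then show "f -` U \<inter> space GB \<in> sets GB"
    unfolding grove.sets_metric_borel space_metric_borel by (intro sigma_sets.Basic) simp
qed (use assms(1) in simp)

lemma grove_map_measurable: "a \<in> I \<Longrightarrow> \<eta> a \<in> measurable GB GB"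
  using grove_agree_antimono[OF grove_map_agree] grove_map_in
  by (intro grove_measurableI) auto

lemma grove_component_measurable:
  assumes v: "v \<in> {1..V}"
  shows "(\<lambda>x. x v) \<in> measurable GB (tree_borel M N)"
  unfolding tree_borel_def
proof (rule tree.measurable_metric_borelI)
  fix U assume U: "openin tree.mtopology U"
  have "openin grove.mtopology ((\<lambda>x. x v) -` U \<inter> G)"
    unfolding openin_grove_iff
  proof (intro conjI ballI)
    fix x assume x: "x \<in> (\<lambda>x. x v) -` U \<inter> G"
    then obtain e where e: "e > 0" "tree.mball (x v) e \<subseteq> U"
      using U unfolding tree.openin_mtopology by auto
    obtain k where k: "1 / real M ^ k < e" using ex_small_radius[OF e(1)] .
    have "y v \<in> U" if y: "y \<in> G" "grove_agree k x y" for y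
    proof -
      have "tree_dist M (x v) (y v) \<le> 1 / real M ^ k"
        using y x v by (subst tree_dist_le_iff) (auto simp: grove_component grove_agree_def)
      then have "y v \<in> tree.mball (x v) e"
        using k x y v by (auto simp: grove_component)
      then show ?thesis using e(2) by blast
    qed
    then show "\<exists>k. \<forall>y\<in>G. grove_agree k x y \<longrightarrow> y \<in> (\<lambda>x. x v) -` U \<inter> G"
      by (intro exI[of _ k]) auto
  qed simp
  then show "(\<lambda>x. x v) -` U \<inter> space GB \<in> sets GB"
    unfolding grove.sets_metric_borel space_metric_borel by (intro sigma_sets.Basic) simp
qed (use v grove_component in auto)

text \<open>Sets decided by the labels below level \<open>k\<close>, that is, unions of classes of
  \<open>grove_agree k\<close>. They play the role of cylinder sets.\<close>

definition saturated :: "nat \<Rightarrow> grove set \<Rightarrow> bool" where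
  "saturated k E \<longleftrightarrow> E \<subseteq> G \<and> (\<forall>x\<in>E. \<forall>y\<in>G. grove_agree k x y \<longrightarrow> y \<in> E)"

lemma saturated_openin: "saturated k E \<Longrightarrow> openin grove.mtopology E"
  unfolding saturated_def openin_grove_iff by blast

lemma saturated_sets: "saturated k E \<Longrightarrow> E \<in> sets GB"
  using saturated_openin unfolding grove.sets_metric_borel by (intro sigma_sets.Basic) auto

text \<open>Saturated sets are open, and every open set is a countable union of saturated
  ones.\<close>

lemma sets_grove_borel: "sets GB = sigma_sets G {E. \<exists>k. saturated k E}"
  unfolding grove.sets_metric_borel
proof (rule sigma_sets_eqI)
  fix U assume "U \<in> {U. openin grove.mtopology U}"
  then have U: "U \<subseteq> G" "\<And>x. x \<in> U \<Longrightarrow> \<exists>k. \<forall>y\<in>G. grove_agree k x y \<longrightarrow> y \<in> U"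
    unfolding openin_grove_iff by auto
  \<comment> \<open>\<open>E k\<close> is the union of the level-k classes contained in
    \<open>U\<close>.\<close>
  define E where "E = (\<lambda>k. {x\<in>U. \<forall>y\<in>G. grove_agree k x y \<longrightarrow> y \<in> U})"
  have "saturated k (E k)" for k
    using U(1) unfolding saturated_def E_def
    by (blast intro: grove_agree_trans)
  then have "(\<Union>k. E k) \<in> sigma_sets G {E. \<exists>k. saturated k E}"
    by (intro sigma_sets.Union sigma_sets.Basic) blast
  moreover have "(\<Union>k. E k) = U" using U(2) unfolding E_def by blast
  ultimately show "U \<in> sigma_sets G {E. \<exists>k. saturated k E}" by simp
next
  fix E assume "E \<in> {E. \<exists>k. saturated k E}"
  then show "E \<in> sigma_sets G {U. openin grove.mtopology U}"
    using saturated_openin by (intro sigma_sets.Basic) blast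
qed

text \<open>The maps gain one level, so preimages lose one. This drives the induction in
  \<open>invariant_measure_unique\<close>.\<close>

lemma saturated_vimage:
  assumes "saturated (Suc k) E" "a \<in> I"
  shows "saturated k (\<eta> a -` E \<inter> G)"
  unfolding saturated_def
proof (intro conjI ballI impI)
  fix x y assume x: "x \<in> \<eta> a -` E \<inter> G" and y: "y \<in> G" and agree: "grove_agree k x y"
  have "\<eta> a y \<in> E"
    using assms(1) x grove_map_in[OF assms(2) y] grove_map_agree[OF assms(2) agree]
    unfolding saturated_def by blast
  then show "y \<in> \<eta> a -` E \<inter> G" using y by simp
qed simp

end

section \<open>The product measure on index sequences and its image on groves\<close>

locale weighted_code_tree_ifs = code_tree_ifs +
  fixes p :: "grove_index \<Rightarrow> real"
  assumes p_nonneg: "\<And>a. a \<in> I \<Longrightarrow> p a \<ge> 0" and p_sum: "(\<Sum>a\<in>I. p a) = 1"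
begin

definition index_measure :: "grove_index measure" where
  "index_measure = point_measure I (\<lambda>a. ennreal (p a))"

lemma space_index_measure [simp]: "space index_measure = I"
  and sets_index_measure [simp]: "sets index_measure = Pow I"
  by (simp_all add: index_measure_def space_point_measure sets_point_measure)

lemma index_measure_prob_space: "prob_space index_measure"
  unfolding index_measure_def
  using p_nonneg p_sum by (intro prob_space_point_measure finite_grove_indices) simp_all

sublocale index: sequence_space index_measure
proof -
  interpret prob_space index_measure by (rule index_measure_prob_space)
  show "sequence_space index_measure" by unfold_locales
qed

abbreviation "W \<equiv> Pi\<^sub>M (UNIV :: nat set) (\<lambda>_. index_measure)"

lemma space_W: "space W = UNIV \<rightarrow>\<^sub>E I"
  by (simp add: space_PiM)

text \<open>The sequences starting with the first \<open>k\<close> letters of \<open>w\<close>,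
  written with singletons in the form for which \<open>index.emeasure_PiM_Collect\<close> gives the
  measure.\<close>

definition cylinder :: "nat \<Rightarrow> (nat \<Rightarrow> grove_index) \<Rightarrow> (nat \<Rightarrow> grove_index) set" where
  "cylinder k w = {s \<in> space W. \<forall>i\<in>{..<k}. s i \<in> {w i}}"

lemma cylinder_sets: "(\<And>i. i < k \<Longrightarrow> w i \<in> I) \<Longrightarrow> cylinder k w \<in> sets W"
  unfolding cylinder_def
  by (intro sets.sets_Collect_finite_All sets_Collect_single') auto

lemma measure_cylinder:
  assumes "\<And>i. i < k \<Longrightarrow> w i \<in> I"
  shows "measure W (cylinder k w) = (\<Prod>i<k. p (w i))"
proof -
  have single: "emeasure index_measure {a} = ennreal (p a)" if "a \<in> I" for a
    using that finite_grove_indices by (simp add: index_measure_def emeasure_point_measure_finite)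
  have "emeasure W (cylinder k w) = (\<Prod>i<k. emeasure index_measure {w i})"
    unfolding cylinder_def using assms by (intro index.emeasure_PiM_Collect) auto
  also have "\<dots> = (\<Prod>i<k. ennreal (p (w i)))"
    by (intro prod.cong refl single assms) simp
  also have "\<dots> = ennreal (\<Prod>i<k. p (w i))"
    using assms p_nonneg by (intro prod_ennreal) simp
  finally have "emeasure W (cylinder k w) = ennreal (\<Prod>i<k. p (w i))" .
  moreover have "0 \<le> (\<Prod>i<k. p (w i))"
    by (intro prod_nonneg) (use assms p_nonneg in simp)
  ultimately show ?thesis unfolding measure_def by simp
qed

text \<open>Whether a coded grove lies in an open set is already ensured by a finite prefix of its
  code when it does. Hence the preimage is a countable union of cylinders, finitely many for each
  length.\<close>

lemma coded_grove_measurable: "coded_grove \<in> measurable W GB"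
proof (rule grove.measurable_metric_borelI)
  show "coded_grove \<in> space W \<rightarrow> G"
    unfolding space_W by (auto intro!: coded_grove_in dest: PiE_mem)
  fix U assume "openin grove.mtopology U"
  then have U: "\<And>x. x \<in> U \<Longrightarrow> \<exists>k. \<forall>y\<in>G. grove_agree k x y \<longrightarrow> y \<in> U"
    unfolding openin_grove_iff by auto
  \<comment> \<open>The words of length \<open>k\<close> whose whole cylinder is sent into
    \<open>U\<close>.\<close>
  define Q where "Q = (\<lambda>k. {w \<in> {..<k} \<rightarrow>\<^sub>E I. \<forall>s\<in>cylinder k w. coded_grove s \<in> U})"
  have "coded_grove -` U \<inter> space W = (\<Union>k. \<Union>w\<in>Q k. cylinder k w)"
  proof (intro equalityI subsetI)
    fix s assume s: "s \<in> coded_grove -` U \<inter> space W"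
    then have sI: "s i \<in> I" for i unfolding space_W by (auto dest: PiE_mem)
    from s U obtain k where k: "\<And>y. y \<in> G \<Longrightarrow> grove_agree k (coded_grove s) y \<Longrightarrow> y \<in> U" by blast
    define w where "w = restrict s {..<k}"
    have "coded_grove t \<in> U" if t: "t \<in> cylinder k w" for t
    proof (rule k)
      have tI: "t i \<in> I" for i using t unfolding cylinder_def space_W by (auto dest: PiE_mem)
      then show "coded_grove t \<in> G" by (rule coded_grove_in)
      show "grove_agree k (coded_grove s) (coded_grove t)"
        using sI tI t by (intro coded_grove_agree) (auto simp: cylinder_def w_def)
    qed
    then have "w \<in> Q k" unfolding Q_def w_def using sI by auto
    moreover have "s \<in> cylinder k w" using s by (simp add: cylinder_def w_def)
    ultimately show "s \<in> (\<Union>k. \<Union>w\<in>Q k. cylinder k w)" by blast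
  next
    fix s assume "s \<in> (\<Union>k. \<Union>w\<in>Q k. cylinder k w)"
    then obtain k w where "w \<in> Q k" "s \<in> cylinder k w" by blast
    then show "s \<in> coded_grove -` U \<inter> space W" by (simp add: Q_def cylinder_def)
  qed
  moreover have "finite (Q k)" for k
    by (rule finite_subset[of _ "{..<k} \<rightarrow>\<^sub>E I"]) (auto simp: Q_def intro!: finite_PiE finite_grove_indices)
  moreover have "cylinder k w \<in> sets W" if "w \<in> Q k" for k w
    using that by (intro cylinder_sets) (auto simp: Q_def dest: PiE_mem)
  ultimately show "coded_grove -` U \<inter> space W \<in> sets W"
    by (auto intro!: sets.countable_UN sets.finite_UN)
qed

definition \<mu> :: "grove measure" where
  "\<mu> = distr W GB coded_grove"

lemma sets_mu [simp]: "sets \<mu> = sets GB" and space_mu [simp]: "space \<mu> = G"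
  by (simp_all add: \<mu>_def)

lemma mu_prob_space: "prob_space \<mu>"
  unfolding \<mu>_def by (rule index.prob_space_distr) (rule coded_grove_measurable)

text \<open>The product measure is unchanged by prefixing an independent index. Integrating over
  that index first gives a finite sum, and prefixing \<open>a\<close> to a code acts on groves as
  \<open>\<eta> a\<close>.\<close>

lemma emeasure_mu_invariant:
  assumes E: "E \<in> sets GB"
  shows "emeasure \<mu> E = (\<Sum>a\<in>I. ennreal (p a) * emeasure \<mu> (\<eta> a -` E \<inter> G))"
proof -
  define X where "X = coded_grove -` E \<inter> space W"
  define f where "f = (\<lambda>(a, s). case_nat a s :: nat \<Rightarrow> grove_index)"
  have f: "f \<in> measurable (index_measure \<Otimes>\<^sub>M W) W" unfolding f_def by measurable
  have X: "X \<in> sets W" unfolding X_def using coded_grove_measurable E by (rule measurable_sets)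
  have Y: "f -` X \<inter> space (index_measure \<Otimes>\<^sub>M W) \<in> sets (index_measure \<Otimes>\<^sub>M W)" (is "?Y \<in> _")
    using f X by (rule measurable_sets)
  have "emeasure \<mu> E = emeasure W X"
    unfolding \<mu>_def X_def using coded_grove_measurable E by (rule emeasure_distr)
  also have "\<dots> = emeasure (distr (index_measure \<Otimes>\<^sub>M W) W f) X"
    unfolding f_def index.PiM_iter ..
  also have "\<dots> = emeasure (index_measure \<Otimes>\<^sub>M W) ?Y"
    using f X by (rule emeasure_distr)
  also have "\<dots> = (\<integral>\<^sup>+a. emeasure W (Pair a -` ?Y) \<partial>index_measure)"
    using Y by (rule index.emeasure_pair_measure_alt)
  also have "\<dots> = (\<Sum>a\<in>I. ennreal (p a) * emeasure W (Pair a -` ?Y))"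
    unfolding index_measure_def by (rule nn_integral_point_measure_finite) (rule finite_grove_indices)
  also have "\<dots> = (\<Sum>a\<in>I. ennreal (p a) * emeasure \<mu> (\<eta> a -` E \<inter> G))"
  proof (intro sum.cong refl arg_cong2[where f = "(*)"])
    fix a assume a: "a \<in> I"
    \<comment> \<open>The section at \<open>a\<close> consists of the sequences whose coded grove is
      moved into \<open>E\<close> by \<open>\<eta> a\<close>.\<close>
    have "Pair a -` ?Y = coded_grove -` (\<eta> a -` E \<inter> G) \<inter> space W"
    proof (rule set_eqI)
      fix s
      show "s \<in> Pair a -` ?Y \<longleftrightarrow> s \<in> coded_grove -` (\<eta> a -` E \<inter> G) \<inter> space W"
      proof (cases "s \<in> space W")
        case True
        then have sI: "s i \<in> I" for i unfolding space_W by (auto dest: PiE_mem)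
        have asI: "case_nat a s i \<in> I" for i using a sI by (cases i) auto
        then have "case_nat a s \<in> space W" unfolding space_W by auto
        moreover have "coded_grove (case_nat a s) = \<eta> a (coded_grove s)"
          using asI by (subst coded_grove_unfold) simp_all
        ultimately show ?thesis
          using True a coded_grove_in[OF sI] by (simp add: X_def f_def space_pair_measure)
      next
        case False
        then show ?thesis by (simp add: space_pair_measure)
      qed
    qed
    moreover have "\<eta> a -` E \<inter> G \<in> sets GB"
      using measurable_sets[OF grove_map_measurable[OF a] E] by simp
    ultimately show "emeasure W (Pair a -` ?Y) = emeasure \<mu> (\<eta> a -` E \<inter> G)"
      unfolding \<mu>_def by (simp add: emeasure_distr[OF coded_grove_measurable])
  qed
  finally show ?thesis .
qed

lemma emeasure_invariant:
  assumes "sets \<nu> = sets GB" "\<nu> = weighted_sum_measure GB I p (\<lambda>a. distr \<nu> GB (\<eta> a))" "E \<in> sets GB"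
  shows "emeasure \<nu> E = (\<Sum>a\<in>I. ennreal (p a) * emeasure \<nu> (\<eta> a -` E \<inter> G))"
proof -
  have sp: "space \<nu> = G" using sets_eq_imp_space_eq[OF assms(1)] by simp
  have "emeasure \<nu> E = emeasure (weighted_sum_measure GB I p (\<lambda>a. distr \<nu> GB (\<eta> a))) E"
    using assms(2) by (rule arg_cong)
  also have "\<dots> = (\<Sum>a\<in>I. ennreal (p a) * emeasure (distr \<nu> GB (\<eta> a)) E)"
    using assms(3) by (intro emeasure_weighted_sum_measure) simp_all
  also have "\<dots> = (\<Sum>a\<in>I. ennreal (p a) * emeasure \<nu> (\<eta> a -` E \<inter> G))"
  proof (intro sum.cong refl arg_cong2[where f = "(*)"])
    fix a assume "a \<in> I"
    then have "\<eta> a \<in> measurable \<nu> GB"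
      using grove_map_measurable measurable_cong_sets[OF assms(1) refl] by blast
    then show "emeasure (distr \<nu> GB (\<eta> a)) E = emeasure \<nu> (\<eta> a -` E \<inter> G)"
      using assms(3) by (simp add: emeasure_distr sp)
  qed
  finally show ?thesis .
qed

text \<open>Invariance expresses the mass of a saturated set of level k + 1 by masses of saturated
  sets of level \<open>k\<close>, so by induction all saturated sets have prescribed mass. They are
  closed under intersection and generate the Borel sets.\<close>

lemma invariant_measure_unique:
  assumes "prob_space \<nu>" "sets \<nu> = sets GB"
    and inv: "\<And>E. E \<in> sets GB \<Longrightarrow> emeasure \<nu> E = (\<Sum>a\<in>I. ennreal (p a) * emeasure \<nu> (\<eta> a -` E \<inter> G))"
  shows "\<nu> = \<mu>"
proof (rule measure_eqI_generator_eq)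
  interpret nu: prob_space \<nu> by fact
  interpret mu: prob_space \<mu> by (rule mu_prob_space)
  have sp: "space \<nu> = G" using sets_eq_imp_space_eq[OF assms(2)] by simp
  show "Int_stable {E. \<exists>k. saturated k E}"
  proof (rule Int_stableI)
    fix A B assume "A \<in> {E. \<exists>k. saturated k E}" "B \<in> {E. \<exists>k. saturated k E}"
    then obtain k l where "saturated k A" "saturated l B" by blast
    then have "saturated (max k l) (A \<inter> B)"
      unfolding saturated_def
      by (meson IntD1 IntD2 IntI grove_agree_antimono le_infI1 max.cobounded1 max.cobounded2)
    then show "A \<inter> B \<in> {E. \<exists>k. saturated k E}" by blast
  qed
  show "{E. \<exists>k. saturated k E} \<subseteq> Pow G" by (auto simp: saturated_def)
  show "sets \<nu> = sigma_sets G {E. \<exists>k. saturated k E}" "sets \<mu> = sigma_sets G {E. \<exists>k. saturated k E}"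
    using assms(2) by (simp_all add: sets_grove_borel)
  show "range (\<lambda>_::nat. G) \<subseteq> {E. \<exists>k. saturated k E}" by (auto simp: saturated_def)
  show "(\<Union>i::nat. G) = G" by simp
  show "emeasure \<nu> G \<noteq> \<infinity>" by simp
  fix E assume "E \<in> {E. \<exists>k. saturated k E}"
  then obtain k where "saturated k E" by blast
  then show "emeasure \<nu> E = emeasure \<mu> E"
  proof (induction k arbitrary: E)
    case 0
    \<comment> \<open>All groves agree below level 0, so they form a single class.\<close>
    then have "E = {} \<or> E = G" unfolding saturated_def grove_agree_def tree_agree_def by blast
    moreover have "emeasure \<nu> G = 1" "emeasure \<mu> G = 1"
      using nu.emeasure_space_1 mu.emeasure_space_1 by (simp_all add: sp)
    ultimately show ?case by auto
  next
    case (Suc k)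
    then have "E \<in> sets GB" using saturated_sets by blast
    then show ?case
      using Suc.IH[OF saturated_vimage[OF Suc.prems]] by (simp add: inv emeasure_mu_invariant)
  qed
qed

lemma grove_measure_eq: "grove_measure M N V p = \<mu>"
  unfolding grove_measure_def measure_attractor_def
proof (rule the_equality)
  have "\<mu> = weighted_sum_measure GB I p (\<lambda>a. distr \<mu> GB (\<eta> a))"
  proof (rule measure_eqI)
    fix E assume "E \<in> sets \<mu>"
    then have E: "E \<in> sets GB" by simp
    have "\<eta> a \<in> measurable \<mu> GB" if "a \<in> I" for a
      using grove_map_measurable[OF that] measurable_cong_sets[OF sets_mu refl] by blast
    with E show "emeasure \<mu> E = emeasure (weighted_sum_measure GB I p (\<lambda>a. distr \<mu> GB (\<eta> a))) E"
      by (subst emeasure_weighted_sum_measure) (auto simp: emeasure_mu_invariant emeasure_distr)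
  qed simp
  then show "prob_space \<mu> \<and> sets \<mu> = sets GB \<and> \<mu> = weighted_sum_measure GB I p (\<lambda>a. distr \<mu> GB (\<eta> a))"
    using mu_prob_space by simp
next
  fix \<nu> assume "prob_space \<nu> \<and> sets \<nu> = sets GB \<and> \<nu> = weighted_sum_measure GB I p (\<lambda>a. distr \<nu> GB (\<eta> a))"
  then show "\<nu> = \<mu>" using emeasure_invariant by (intro invariant_measure_unique) blast+
qed

text \<open>Write the mass of the event that the v-th tree lies in \<open>B\<close> by invariance
  and reindex the sum by exchanging \<open>a v\<close> and \<open>a w\<close>. The weights,
  symmetric in the positions, do not change, and the event becomes the one for the w-th
  tree.\<close>

lemma component_distr_eq:
  assumes sym: "\<And>a. a \<in> I \<Longrightarrow> p a = (\<Prod>v=1..V. P (fst (a v))) / c"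
    and v: "v \<in> {1..V}" and w: "w \<in> {1..V}"
  shows "distr \<mu> (tree_borel M N) (\<lambda>x. x v) = distr \<mu> (tree_borel M N) (\<lambda>x. x w)"
proof (rule measure_eqI)
  \<comment> \<open>Only the positions are exchanged; the references stored inside
    \<open>a v\<close> and \<open>a w\<close> are kept. So both indices act on the same grove
    \<open>x\<close> and produce the same tree, in position \<open>v\<close> or
    \<open>w\<close>.\<close>
  define \<sigma> where "\<sigma> = (\<lambda>(a::grove_index) u. a (Transposition.transpose v w u))"
  have invol: "\<sigma> (\<sigma> a) = a" for a by (simp add: \<sigma>_def)
  have \<sigma>_in: "\<sigma> a \<in> I" if "a \<in> I" for a
  proof -
    have "Transposition.transpose v w u \<in> {1..V}" if "u \<in> {1..V}" for u
      using that v w by (auto simp: Transposition.transpose_def)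
    moreover have "Transposition.transpose v w u = u" if "u \<notin> {1..V}" for u
      using that v w by (auto simp: Transposition.transpose_def)
    ultimately show ?thesis
      using that unfolding grove_indices_def \<sigma>_def PiE_iff extensional_def by simp
  qed
  have p_\<sigma>: "p (\<sigma> a) = p a" if "a \<in> I" for a
  proof -
    have "(\<Prod>u=1..V. P (fst (a u))) = (\<Prod>u=1..V. P (fst (\<sigma> a u)))"
      using prod.permute[OF permutes_swap_id[OF v w], of "\<lambda>u. P (fst (a u))"] by (simp add: \<sigma>_def comp_def)
    then show ?thesis using sym[OF that] sym[OF \<sigma>_in[OF that]] by simp
  qed
  fix B assume "B \<in> sets (distr \<mu> (tree_borel M N) (\<lambda>x. x v))"
  then have B: "B \<in> sets (tree_borel M N)" by simp
  have E: "(\<lambda>x. x u) -` B \<inter> G \<in> sets GB" if "u \<in> {1..V}" for u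
    using measurable_sets[OF grove_component_measurable[OF that] B] by simp
  have swap: "\<eta> (\<sigma> a) x w = \<eta> a x v" for a x
    using v w by (simp add: grove_map_def \<sigma>_def)
  have meas: "(\<lambda>x. x u) \<in> measurable \<mu> (tree_borel M N)" if "u \<in> {1..V}" for u
    using grove_component_measurable[OF that] measurable_cong_sets[OF sets_mu refl] by blast
  have "emeasure \<mu> ((\<lambda>x. x v) -` B \<inter> G) =
      (\<Sum>a\<in>I. ennreal (p a) * emeasure \<mu> (\<eta> a -` ((\<lambda>x. x v) -` B \<inter> G) \<inter> G))"
    by (rule emeasure_mu_invariant[OF E[OF v]])
  also have "\<dots> = (\<Sum>a\<in>I. ennreal (p a) * emeasure \<mu> (\<eta> a -` ((\<lambda>x. x w) -` B \<inter> G) \<inter> G))"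
  proof (rule sum.reindex_bij_witness[of _ \<sigma> \<sigma>])
    fix a assume a: "a \<in> I"
    have "\<eta> (\<sigma> a) -` ((\<lambda>x. x w) -` B \<inter> G) \<inter> G = \<eta> a -` ((\<lambda>x. x v) -` B \<inter> G) \<inter> G"
      using grove_map_in[OF a] grove_map_in[OF \<sigma>_in[OF a]] by (auto simp: swap)
    then show "ennreal (p (\<sigma> a)) * emeasure \<mu> (\<eta> (\<sigma> a) -` ((\<lambda>x. x w) -` B \<inter> G) \<inter> G) =
        ennreal (p a) * emeasure \<mu> (\<eta> a -` ((\<lambda>x. x v) -` B \<inter> G) \<inter> G)"
      by (simp only: p_\<sigma>[OF a])
  qed (simp_all add: invol \<sigma>_in)
  also have "\<dots> = emeasure \<mu> ((\<lambda>x. x w) -` B \<inter> G)"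
    by (rule emeasure_mu_invariant[OF E[OF w], symmetric])
  finally show "emeasure (distr \<mu> (tree_borel M N) (\<lambda>x. x v)) B = emeasure (distr \<mu> (tree_borel M N) (\<lambda>x. x w)) B"
    using v w B by (simp add: emeasure_distr meas)
qed simp

end

section \<open>Convergence of empirical averages\<close>

text \<open>The empirical measure is the image under \<open>x\<close> of the measure with mass 1/n
  at each of 1, ..., n, so the integral becomes a finite sum. For n = 0 both sides are 0.\<close>

lemma integral_empirical_measure:
  fixes f :: "'a \<Rightarrow> real"
  assumes "f \<in> borel_measurable B" "\<And>l. l \<in> {1..n} \<Longrightarrow> x l \<in> space B"
  shows "(\<integral>y. f y \<partial>(empirical_measure B x n)) = (\<Sum>l=1..n. f (x l)) / real n"
proof -
  define D where "D = point_measure {1..n} (\<lambda>_. ennreal (1 / real n))"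
  have x: "x \<in> measurable D B" using assms(2) by (simp add: D_def)
  have "empirical_measure B x n = distr D B x"
  proof (rule measure_eqI)
    fix E assume "E \<in> sets (empirical_measure B x n)"
    then have E: "E \<in> sets B" by (simp add: empirical_measure_def)
    have "emeasure (empirical_measure B x n) E =
        (\<Sum>l=1..n. ennreal (1 / real n) * emeasure (return B (x l)) E)"
      unfolding empirical_measure_def using E by (intro emeasure_weighted_sum_measure) simp_all
    also have "\<dots> = (\<Sum>l\<in>{1..n}. if x l \<in> E then ennreal (1 / real n) else 0)"
      using E by (intro sum.cong refl) (simp add: indicator_def)
    also have "\<dots> = (\<Sum>l\<in>{l\<in>{1..n}. x l \<in> E}. ennreal (1 / real n))"
      by (rule sum.inter_filter[symmetric]) simp
    also have "{l\<in>{1..n}. x l \<in> E} = x -` E \<inter> {1..n}" by auto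
    also have "(\<Sum>l\<in>x -` E \<inter> {1..n}. ennreal (1 / real n)) = emeasure D (x -` E \<inter> {1..n})"
      unfolding D_def by (intro emeasure_point_measure_finite[symmetric]) auto
    also have "\<dots> = emeasure (distr D B x) E"
      using x E by (simp add: emeasure_distr) (simp add: D_def space_point_measure)
    finally show "emeasure (empirical_measure B x n) E = emeasure (distr D B x) E" .
  qed (simp add: empirical_measure_def)
  then have "(\<integral>y. f y \<partial>(empirical_measure B x n)) = (\<integral>l. f (x l) \<partial>D)"
    using x assms(1) by (simp add: integral_distr)
  also have "\<dots> = (\<Sum>l=1..n. 1 / real n * f (x l))"
    unfolding D_def by (subst lebesgue_integral_point_measure_finite) simp_all
  finally show ?thesis by (simp add: sum_divide_distrib)
qed

text \<open>Shifting by \<open>k\<close> changes the sum by at most 2 k terms of bounded size, which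
  division by \<open>n\<close> makes negligible.\<close>

lemma average_shift_tendsto_0:
  fixes c :: "nat \<Rightarrow> real"
  assumes bound: "\<And>l. l \<ge> 1 \<Longrightarrow> \<bar>c l\<bar> \<le> B"
  shows "(\<lambda>n. (\<Sum>l=1..n. c l) / real n - (\<Sum>l=1..n. c (l + k)) / real n) \<longlonglongrightarrow> 0"
proof (rule Lim_null_comparison)
  have diff: "\<bar>(\<Sum>l=1..n. c l) - (\<Sum>l=1..n. c (l + k))\<bar> \<le> 2 * real k * B" for n
  proof (induction k)
    case (Suc k)
    \<comment> \<open>A shift by one more drops the first term and adds one at the end.\<close>
    have "(\<Sum>l=1..n. c (l + k)) - (\<Sum>l=1..n. c (l + Suc k)) = c (1 + k) - c (n + 1 + k)"
      by (induction n) simp_all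
    moreover have "\<bar>c (1 + k)\<bar> \<le> B" "\<bar>c (n + 1 + k)\<bar> \<le> B" using bound by simp_all
    ultimately have "\<bar>(\<Sum>l=1..n. c l) - (\<Sum>l=1..n. c (l + Suc k))\<bar> \<le> 2 * real k * B + 2 * B"
      using Suc by linarith
    then show ?case by (simp add: algebra_simps)
  qed simp
  show "\<forall>\<^sub>F n in sequentially. norm ((\<Sum>l=1..n. c l) / real n - (\<Sum>l=1..n. c (l + k)) / real n)
      \<le> 2 * real k * B / real n"
  proof (intro always_eventually allI)
    fix n
    have "norm ((\<Sum>l=1..n. c l) / real n - (\<Sum>l=1..n. c (l + k)) / real n) =
        \<bar>(\<Sum>l=1..n. c l) - (\<Sum>l=1..n. c (l + k))\<bar> / real n"
      by (simp flip: diff_divide_distrib)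
    also have "\<dots> \<le> 2 * real k * B / real n"
      by (intro divide_right_mono diff) simp
    finally show "norm ((\<Sum>l=1..n. c l) / real n - (\<Sum>l=1..n. c (l + k)) / real n)
      \<le> 2 * real k * B / real n" .
  qed
  show "(\<lambda>n. 2 * real k * B / real n) \<longlonglongrightarrow> 0"
    by (rule lim_const_over_n)
qed

text \<open>The approximating sequence may depend on the tolerance. Three errors of a quarter of the
  tolerance stay strictly below it.\<close>

lemma LIMSEQ_approx:
  fixes a :: "nat \<Rightarrow> real"
  assumes "\<And>e. e > 0 \<Longrightarrow> \<exists>b G. b \<longlonglongrightarrow> G \<and> (\<forall>\<^sub>F n in sequentially. \<bar>a n - b n\<bar> \<le> e) \<and> \<bar>G - L\<bar> \<le> e"
  shows "a \<longlonglongrightarrow> L"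
proof (rule tendstoI)
  fix e :: real assume "e > 0"
  then have "e / 4 > 0" by simp
  from assms[OF this] obtain b G where b: "b \<longlonglongrightarrow> G"
    "\<forall>\<^sub>F n in sequentially. \<bar>a n - b n\<bar> \<le> e / 4" "\<bar>G - L\<bar> \<le> e / 4" by blast
  from tendstoD[OF b(1) \<open>e / 4 > 0\<close>] b(2)
  show "\<forall>\<^sub>F n in sequentially. dist (a n) L < e"
  proof eventually_elim
    case (elim n)
    then show ?case using b(3) \<open>e > 0\<close> unfolding dist_real_def by linarith
  qed
qed

lemma abs_average_diff_le:
  fixes c d :: "nat \<Rightarrow> real"
  assumes "\<And>l. l \<in> {1..n} \<Longrightarrow> \<bar>c l - d l\<bar> \<le> e" "e \<ge> 0"
  shows "\<bar>(\<Sum>l=1..n. c l) / real n - (\<Sum>l=1..n. d l) / real n\<bar> \<le> e"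
proof -
  have "\<bar>(\<Sum>l=1..n. c l) - (\<Sum>l=1..n. d l)\<bar> = \<bar>\<Sum>l=1..n. c l - d l\<bar>"
    by (simp add: sum_subtractf)
  also have "\<dots> \<le> (\<Sum>l=1..n. \<bar>c l - d l\<bar>)" by (rule sum_abs)
  also have "\<dots> \<le> (\<Sum>l=1..n. e)" by (intro sum_mono assms)
  finally have "\<bar>(\<Sum>l=1..n. c l) - (\<Sum>l=1..n. d l)\<bar> \<le> real n * e" by simp
  then have "\<bar>(\<Sum>l=1..n. c l) - (\<Sum>l=1..n. d l)\<bar> / real n \<le> e"
    using assms(2) by (cases "n = 0") (simp_all add: divide_le_eq mult.commute)
  then show ?thesis by (simp flip: diff_divide_distrib)
qed

section \<open>Convergence along one realisation, and almost surely\<close>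

context weighted_code_tree_ifs
begin

text \<open>Codes are infinite, so a finite word is continued by a fixed arbitrary index. By
  \<open>coded_grove_agree\<close> the levels below \<open>k\<close> do not depend on that
  choice.\<close>

definition pad_word :: "nat \<Rightarrow> (nat \<Rightarrow> grove_index) \<Rightarrow> nat \<Rightarrow> grove_index" where
  "pad_word k w i = (if i < k then w i else (SOME a. a \<in> I))"

lemma pad_word_in: "(\<And>i. i < k \<Longrightarrow> w i \<in> I) \<Longrightarrow> pad_word k w i \<in> I"
  using grove_index_exists by (simp add: pad_word_def some_in_eq)

text \<open>Exactly one word of length \<open>k\<close> matches the prefix of \<open>s\<close>. This
  writes a function of the prefix as a linear combination of occurrences of words.\<close>

lemma sum_over_words:
  fixes g :: "(nat \<Rightarrow> grove_index) \<Rightarrow> real"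
  assumes "\<And>i. i < k \<Longrightarrow> s i \<in> I"
  shows "(\<Sum>w\<in>{..<k} \<rightarrow>\<^sub>E I. of_bool (\<forall>i<k. s i = w i) * g w) = g (restrict s {..<k})"
proof -
  have "(\<forall>i<k. s i = w i) \<longleftrightarrow> w = restrict s {..<k}" if "w \<in> {..<k} \<rightarrow>\<^sub>E I" for w
  proof
    assume "\<forall>i<k. s i = w i"
    then show "w = restrict s {..<k}"
      using that by (auto simp: fun_eq_iff restrict_def PiE_iff extensional_def)
  qed simp
  then have "(\<Sum>w\<in>{..<k} \<rightarrow>\<^sub>E I. of_bool (\<forall>i<k. s i = w i) * g w) =
      (\<Sum>w\<in>{..<k} \<rightarrow>\<^sub>E I. if w = restrict s {..<k} then g w else 0)"
    by (intro sum.cong) auto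
  also have "\<dots> = g (restrict s {..<k})"
  proof -
    have "finite ({..<k} \<rightarrow>\<^sub>E I)" by (intro finite_PiE finite_grove_indices) simp
    moreover have "restrict s {..<k} \<in> {..<k} \<rightarrow>\<^sub>E I" using assms by simp
    ultimately show ?thesis by simp
  qed
  finally show ?thesis .
qed

text \<open>A deterministic statement about a single realisation. Up to e/2 the value at time l + k
  is a function \<open>H\<close> of the last \<open>k\<close> indices; averages of \<open>H\<close>
  converge by the word frequencies to its integral against the product measure, which is again
  e/2-close to the integral of \<open>f\<close>.\<close>

lemma average_tendsto_integral:
  fixes f :: "code_tree \<Rightarrow> real"
  assumes \<alpha>: "\<And>l. l \<ge> 1 \<Longrightarrow> \<alpha> l \<in> I"
    and x1: "x 1 \<in> G" and x_Suc: "\<And>l. l \<ge> 1 \<Longrightarrow> x (l + 1) = \<eta> (\<alpha> l) (x l)"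
    and freq: "\<And>k w. w \<in> {..<k} \<rightarrow>\<^sub>E I \<Longrightarrow>
      (\<lambda>n. (\<Sum>l=1..n. of_bool (\<forall>i<k. \<alpha> (l + k - 1 - i) = w i)) / real n) \<longlonglongrightarrow> (\<Prod>i<k. p (w i))"
    and v: "v \<in> {1..V}"
    and f: "continuous_map tree.mtopology euclideanreal f"
  shows "(\<lambda>n. (\<Sum>l=1..n. f (x l v)) / real n) \<longlonglongrightarrow> (\<integral>y. f (y v) \<partial>\<mu>)"
proof (rule LIMSEQ_approx)
  have x_in: "x l \<in> G" if "l \<ge> 1" for l
    using that by (induction l rule: dec_induct) (use x1 x_Suc \<alpha> grove_map_in in auto)
  have "compactin euclideanreal (f ` topspace tree.mtopology)"
    using tree_compact f unfolding compact_space_def by (rule image_compactin)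
  then have "bounded (f ` \<Omega>)" by (simp add: compact_imp_bounded)
  then obtain B where B: "\<And>\<omega>. \<omega> \<in> \<Omega> \<Longrightarrow> \<bar>f \<omega>\<bar> \<le> B" unfolding bounded_iff by auto
  fix e :: real assume "e > 0"
  then have e2: "e / 2 > 0" by simp
  obtain k where k: "\<And>\<omega> \<kappa>. \<omega> \<in> \<Omega> \<Longrightarrow> \<kappa> \<in> \<Omega> \<Longrightarrow> tree_agree k \<omega> \<kappa> \<Longrightarrow> \<bar>f \<omega> - f \<kappa>\<bar> < e / 2"
    using tree_uniform_continuity[OF f e2] by blast
  define \<psi> where "\<psi> = (\<lambda>w. f (coded_grove (pad_word k w) v))"
  define H where "H = (\<lambda>s. \<Sum>w\<in>{..<k} \<rightarrow>\<^sub>E I. of_bool (\<forall>i<k. s i = w i) * \<psi> w)"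
  \<comment> \<open>The indices of the window are listed latest first, since the map applied last is
    the outermost one and hence the first letter of the code.\<close>
  define word where "word = (\<lambda>l i. \<alpha> (l + k - 1 - i))"
  define L where "L = (\<Sum>w\<in>{..<k} \<rightarrow>\<^sub>E I. (\<Prod>i<k. p (w i)) * \<psi> w)"
  have H_eq: "H s = \<psi> (restrict s {..<k})" if "\<And>i. i < k \<Longrightarrow> s i \<in> I" for s
    unfolding H_def using that by (rule sum_over_words)
  have H_close: "\<bar>f (y v) - H s\<bar> \<le> e / 2"
    if s: "\<And>i. i < k \<Longrightarrow> s i \<in> I" and y: "y \<in> G"
      and agree: "grove_agree k y (coded_grove (pad_word k (restrict s {..<k})))" for s y
  proof -
    have c: "coded_grove (pad_word k (restrict s {..<k})) \<in> G"
      by (intro coded_grove_in pad_word_in) (simp add: s)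
    have "tree_agree k (y v) (coded_grove (pad_word k (restrict s {..<k})) v)"
      using agree v unfolding grove_agree_def by blast
    then have "\<bar>f (y v) - \<psi> (restrict s {..<k})\<bar> < e / 2"
      unfolding \<psi>_def by (rule k[OF grove_component[OF y v] grove_component[OF c v]])
    then show ?thesis by (simp add: H_eq[OF s])
  qed
  have word_in: "word l i \<in> I" if "l \<ge> 1" "i < k" for l i
    unfolding word_def using that by (intro \<alpha>) simp
  have x_close: "\<bar>f (x (l + k) v) - H (word l)\<bar> \<le> e / 2" if l: "l \<ge> 1" for l
  proof (rule H_close)
    show "x (l + k) \<in> G" using l by (intro x_in) simp
    \<comment> \<open>Reversing time makes the last \<open>k\<close> steps a backward orbit; the
      earlier grove \<open>x l\<close> affects only the levels from \<open>k\<close> on.\<close>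
    have "grove_agree k (x (l + k - 0)) (coded_grove (pad_word k (restrict (word l) {..<k})))"
    proof (rule orbit_agree_coded_grove[where y = "\<lambda>i. x (l + k - i)"])
      show "pad_word k (restrict (word l) {..<k}) i \<in> I" for i
        by (rule pad_word_in) (simp add: word_in[OF l])
      fix i assume i: "i < k"
      have "l + k - i = (l + k - Suc i) + 1" using i by simp
      then have "x (l + k - i) = x ((l + k - Suc i) + 1)" by (rule arg_cong)
      also have "\<dots> = \<eta> (\<alpha> (l + k - Suc i)) (x (l + k - Suc i))"
        using i l by (intro x_Suc) simp
      also have "\<alpha> (l + k - Suc i) = pad_word k (restrict (word l) {..<k}) i"
        using i by (simp add: pad_word_def word_def)
      finally show "x (l + k - i) = \<eta> (pad_word k (restrict (word l) {..<k}) i) (x (l + k - Suc i))" .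
    qed
    then show "grove_agree k (x (l + k)) (coded_grove (pad_word k (restrict (word l) {..<k})))" by simp
  qed (rule word_in[OF l])
  have "(\<lambda>n. (\<Sum>l=1..n. H (word l)) / real n) \<longlonglongrightarrow> L"
  proof -
    have "(\<lambda>n. \<Sum>w\<in>{..<k} \<rightarrow>\<^sub>E I. (\<Sum>l=1..n. of_bool (\<forall>i<k. \<alpha> (l + k - 1 - i) = w i)) / real n * \<psi> w) \<longlonglongrightarrow> L"
      unfolding L_def by (intro tendsto_sum tendsto_mult freq tendsto_const)
    moreover have "(\<Sum>w\<in>{..<k} \<rightarrow>\<^sub>E I. (\<Sum>l=1..n. of_bool (\<forall>i<k. \<alpha> (l + k - 1 - i) = w i)) / real n * \<psi> w) =
        (\<Sum>l=1..n. H (word l)) / real n" for n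
    proof -
      have "(\<Sum>l=1..n. H (word l)) =
          (\<Sum>w\<in>{..<k} \<rightarrow>\<^sub>E I. \<Sum>l=1..n. of_bool (\<forall>i<k. word l i = w i) * \<psi> w)"
        unfolding H_def by (rule sum.swap)
      then show ?thesis by (simp add: word_def sum_divide_distrib flip: sum_distrib_right)
    qed
    ultimately show ?thesis by simp
  qed
  moreover have "\<forall>\<^sub>F n in sequentially. \<bar>(\<Sum>l=1..n. f (x l v)) / real n - (\<Sum>l=1..n. H (word l)) / real n\<bar> \<le> e"
  proof -
    have "\<bar>f (x l v)\<bar> \<le> B" if "l \<ge> 1" for l
      using that v x_in by (intro B grove_component)
    \<comment> \<open>The averages start at time 1 but \<open>H\<close> approximates at time l + k;
      this shift uses the other e/2.\<close>
    then have "(\<lambda>n. (\<Sum>l=1..n. f (x l v)) / real n - (\<Sum>l=1..n. f (x (l + k) v)) / real n) \<longlonglongrightarrow> 0"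
      by (rule average_shift_tendsto_0)
    from tendstoD[OF this e2] show ?thesis
    proof eventually_elim
      case (elim n)
      have "\<bar>(\<Sum>l=1..n. f (x (l + k) v)) / real n - (\<Sum>l=1..n. H (word l)) / real n\<bar> \<le> e / 2"
        using e2 by (intro abs_average_diff_le x_close) simp_all
      with elim show ?case unfolding dist_real_def by linarith
    qed
  qed
  \<comment> \<open>\<open>L\<close> is the integral of \<open>H\<close> over sequences, where
    \<open>H\<close> is uniformly e/2-close to the value of \<open>f\<close> at the coded
    tree.\<close>
  moreover have "\<bar>L - (\<integral>y. f (y v) \<partial>\<mu>)\<bar> \<le> e"
  proof -
    have [measurable]: "f \<in> borel_measurable (tree_borel M N)"
      unfolding tree_borel_def using f by (rule tree.continuous_map_measurable_metric_borel)
    note [measurable] = grove_component_measurable[OF v] coded_grove_measurable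
    have int: "(\<integral>y. f (y v) \<partial>\<mu>) = (\<integral>s. f (coded_grove s v) \<partial>W)"
      unfolding \<mu>_def by (intro integral_distr) measurable
    have sI: "s i \<in> I" if "s \<in> space W" for s i
      using that unfolding space_W by (auto dest: PiE_mem)
    have F_int: "integrable W (\<lambda>s. f (coded_grove s v))"
    proof (rule index.integrable_const_bound)
      show "AE s in W. norm (f (coded_grove s v)) \<le> B"
        using v by (intro AE_I2) (auto intro!: B grove_component coded_grove_in sI)
    qed measurable
    have cyl: "cylinder k w \<in> sets W" "measure W (cylinder k w) = (\<Prod>i<k. p (w i))"
      if "w \<in> {..<k} \<rightarrow>\<^sub>E I" for w
      using that by (auto intro!: cylinder_sets measure_cylinder dest: PiE_mem)
    have cyl_int: "integrable W (\<lambda>s. indicator (cylinder k w) s * \<psi> w)" if "w \<in> {..<k} \<rightarrow>\<^sub>E I" for w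
    proof (rule integrable_mult_left)
      show "integrable W (indicator (cylinder k w) :: _ \<Rightarrow> real)"
        using cyl(1)[OF that] by (rule integrable_real_indicator) (simp add: index.emeasure_eq_measure)
    qed
    \<comment> \<open>On the sequence space the occurrence of \<open>w\<close> as a prefix is its
      cylinder, whose measure is the limiting frequency of \<open>w\<close>.\<close>
    have H_W: "H s = (\<Sum>w\<in>{..<k} \<rightarrow>\<^sub>E I. indicator (cylinder k w) s * \<psi> w)" if "s \<in> space W" for s
    proof -
      have "of_bool (\<forall>i<k. s i = w i) = (indicator (cylinder k w) s :: real)" for w
        using that by (simp add: cylinder_def indicator_def Ball_def)
      then show ?thesis unfolding H_def by (simp only:)
    qed
    have H_int: "integrable W H"
    proof (subst Bochner_Integration.integrable_cong[OF refl])
      show "H s = (\<Sum>w\<in>{..<k} \<rightarrow>\<^sub>E I. indicator (cylinder k w) s * \<psi> w)" if "s \<in> space W" for s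
        using that by (rule H_W)
    qed (use cyl_int in \<open>rule Bochner_Integration.integrable_sum\<close>)
    have "(\<integral>s. H s \<partial>W) = (\<integral>s. (\<Sum>w\<in>{..<k} \<rightarrow>\<^sub>E I. indicator (cylinder k w) s * \<psi> w) \<partial>W)"
      by (intro Bochner_Integration.integral_cong refl H_W)
    also have "\<dots> = (\<Sum>w\<in>{..<k} \<rightarrow>\<^sub>E I. (\<integral>s. indicator (cylinder k w) s * \<psi> w \<partial>W))"
      using cyl_int by (rule Bochner_Integration.integral_sum)
    also have "\<dots> = L"
      unfolding L_def
    proof (intro sum.cong refl)
      fix w assume w: "w \<in> {..<k} \<rightarrow>\<^sub>E I"
      then show "(\<integral>s. indicator (cylinder k w) s * \<psi> w \<partial>W) = (\<Prod>i<k. p (w i)) * \<psi> w"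
        using cyl[OF w] sets.sets_into_space[OF cyl(1)[OF w]] by (simp add: Int_absorb2)
    qed
    finally have diff: "L - (\<integral>y. f (y v) \<partial>\<mu>) = (\<integral>s. H s - f (coded_grove s v) \<partial>W)"
      unfolding int by (simp add: F_int H_int)
    have close: "\<bar>f (coded_grove s v) - H s\<bar> \<le> e / 2" if "s \<in> space W" for s
    proof (rule H_close)
      show "coded_grove s \<in> G" using sI[OF that] by (rule coded_grove_in)
      show "grove_agree k (coded_grove s) (coded_grove (pad_word k (restrict s {..<k})))"
        using sI[OF that] by (intro coded_grove_agree pad_word_in) (simp_all add: pad_word_def)
    qed (rule sI[OF that])
    have "H s - f (coded_grove s v) \<le> e / 2" "- (e / 2) \<le> H s - f (coded_grove s v)" if "s \<in> space W" for s
      using close[OF that] by linarith+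
    then have "(\<integral>s. H s - f (coded_grove s v) \<partial>W) \<le> e / 2"
      "- (e / 2) \<le> (\<integral>s. H s - f (coded_grove s v) \<partial>W)"
      by (intro index.integral_le_const index.integral_ge_const Bochner_Integration.integrable_diff
          H_int F_int AE_I2; blast)+
    with diff show ?thesis using \<open>e > 0\<close> by linarith
  qed
  ultimately show "\<exists>b G. b \<longlonglongrightarrow> G \<and>
      (\<forall>\<^sub>F n in sequentially. \<bar>(\<Sum>l=1..n. f (x l v)) / real n - b n\<bar> \<le> e) \<and>
      \<bar>G - (\<integral>y. f (y v) \<partial>\<mu>)\<bar> \<le> e"
    by blast
qed

text \<open>\<open>tree_measure\<close> is the marginal at position 1; the symmetry of the weights
  replaces 1 by \<open>v\<close>.\<close>

lemma integral_tree_measure: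
  fixes f :: "code_tree \<Rightarrow> real"
  assumes sym: "\<And>a. a \<in> I \<Longrightarrow> p a = (\<Prod>v=1..V. P (fst (a v))) / c"
    and v: "v \<in> {1..V}" and f: "f \<in> borel_measurable (tree_borel M N)"
  shows "(\<integral>\<omega>. f \<omega> \<partial>(tree_measure M N V p)) = (\<integral>y. f (y v) \<partial>\<mu>)"
proof -
  have "1 \<in> {1..V}" using V_ge by simp
  then have "tree_measure M N V p = distr \<mu> (tree_borel M N) (\<lambda>y. y v)"
    unfolding tree_measure_def grove_measure_eq using v by (intro component_distr_eq[OF sym])
  moreover have "(\<lambda>y. y v) \<in> measurable \<mu> (tree_borel M N)"
    using grove_component_measurable[OF v] measurable_cong_sets[OF sets_mu refl] by blast
  ultimately show ?thesis using f by (simp add: integral_distr)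
qed

text \<open>Randomness enters only through the word frequencies. The exceptional null set is fixed
  before \<open>v\<close> and the test function are chosen, so it serves all of them at
  once.\<close>

lemma empirical_measures_converge:
  fixes S :: "'s measure" and \<alpha> :: "nat \<Rightarrow> 's \<Rightarrow> grove_index" and x :: "nat \<Rightarrow> 's \<Rightarrow> grove"
  assumes sym: "\<And>a. a \<in> I \<Longrightarrow> p a = (\<Prod>v=1..V. P (fst (a v))) / c"
    and "prob_space S"
    and indep: "prob_space.indep_vars S (\<lambda>_. count_space I) \<alpha> {1..}"
    and law: "\<And>l a. l \<ge> 1 \<Longrightarrow> a \<in> I \<Longrightarrow> measure S {s \<in> space S. \<alpha> l s = a} = p a"
    and x1: "\<And>s. s \<in> space S \<Longrightarrow> x 1 s \<in> G"
    and x_Suc: "\<And>s l. s \<in> space S \<Longrightarrow> l \<ge> 1 \<Longrightarrow> x (l + 1) s = \<eta> (\<alpha> l s) (x l s)"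
  shows "AE s in S. \<forall>v\<in>{1..V}. weakly_converges tree.mtopology
           (empirical_measure (tree_borel M N) (\<lambda>l. x l s v)) (tree_measure M N V p)"
proof -
  interpret S: prob_space S by fact
  \<comment> \<open>Independence includes measurability into \<open>count_space I\<close>, which
    forces the values to be in \<open>I\<close> at every sample point.\<close>
  have \<alpha>: "\<alpha> l s \<in> I" if "l \<ge> 1" "s \<in> space S" for l s
  proof -
    have "\<alpha> l \<in> measurable S (count_space I)"
      using indep that(1) unfolding S.indep_vars_def by simp
    from measurable_space[OF this that(2)] show ?thesis by simp
  qed
  \<comment> \<open>There are countably many lengths and finitely many words of each, so the null
    sets can be united.\<close>
  have "AE s in S. \<forall>k. \<forall>w\<in>{..<k} \<rightarrow>\<^sub>E I.
      (\<lambda>n. (\<Sum>l=1..n. of_bool (\<forall>i<k. \<alpha> (l + k - 1 - i) s = w i)) / real n) \<longlonglongrightarrow> (\<Prod>i<k. p (w i))"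
    unfolding AE_all_countable
  proof
    fix k :: nat
    have "countable ({..<k} \<rightarrow>\<^sub>E I)"
      by (intro countable_finite finite_PiE finite_grove_indices) simp
    moreover have "AE s in S.
      (\<lambda>n. (\<Sum>l=1..n. of_bool (\<forall>i<k. \<alpha> (l + k - 1 - i) s = w i)) / real n) \<longlonglongrightarrow> (\<Prod>i<k. p (w i))"
      if "w \<in> {..<k} \<rightarrow>\<^sub>E I" for w
      by (rule S.word_frequency[OF indep law]) (use that in \<open>auto dest: PiE_mem\<close>)
    ultimately show "AE s in S. \<forall>w\<in>{..<k} \<rightarrow>\<^sub>E I.
      (\<lambda>n. (\<Sum>l=1..n. of_bool (\<forall>i<k. \<alpha> (l + k - 1 - i) s = w i)) / real n) \<longlonglongrightarrow> (\<Prod>i<k. p (w i))"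
      by (simp add: AE_ball_countable)
  qed
  then show ?thesis using AE_space
  proof eventually_elim
    case (elim s)
    have x_in: "x l s \<in> G" if "l \<ge> 1" for l
      using that by (induction l rule: dec_induct) (use x1 x_Suc \<alpha> grove_map_in elim(2) in auto)
    show ?case
      unfolding weakly_converges_def
    proof (intro ballI allI impI)
      fix v f assume v: "v \<in> {1..V}"
        and "continuous_map tree.mtopology euclideanreal f \<and> bounded (f ` topspace tree.mtopology)"
      then have f: "continuous_map tree.mtopology euclideanreal f" by blast
      have f_meas: "f \<in> borel_measurable (tree_borel M N)"
        unfolding tree_borel_def using f by (rule tree.continuous_map_measurable_metric_borel)
      have "(\<integral>\<omega>. f \<omega> \<partial>(empirical_measure (tree_borel M N) (\<lambda>l. x l s v) n)) =
          (\<Sum>l=1..n. f (x l s v)) / real n" for n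
        using x_in v by (intro integral_empirical_measure f_meas)
          (simp add: tree_borel_def grove_component)
      moreover have "(\<lambda>n. (\<Sum>l=1..n. f (x l s v)) / real n) \<longlonglongrightarrow> (\<integral>y. f (y v) \<partial>\<mu>)"
      proof (rule average_tendsto_integral[where \<alpha> = "\<lambda>l. \<alpha> l s", OF _ _ _ _ v f])
        show "(\<lambda>n. (\<Sum>l=1..n. of_bool (\<forall>i<k. \<alpha> (l + k - 1 - i) s = w i)) / real n) \<longlonglongrightarrow> (\<Prod>i<k. p (w i))"
          if "w \<in> {..<k} \<rightarrow>\<^sub>E I" for k w
          using elim(1) that by blast
      qed (use \<alpha> x1 x_Suc elim(2) in simp_all)
      ultimately show "(\<lambda>n. \<integral>\<omega>. f \<omega> \<partial>(empirical_measure (tree_borel M N) (\<lambda>l. x l s v) n))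
          \<longlonglongrightarrow> (\<integral>\<omega>. f \<omega> \<partial>(tree_measure M N V p))"
        by (simp add: integral_tree_measure[OF sym v f_meas])
    qed
  qed
qed

end

theorem theorem10:
  fixes M N V :: nat and P :: "nat \<Rightarrow> real" and p :: "grove_index \<Rightarrow> real"
  assumes "M \<ge> 2" and "N \<ge> 1" and "V \<ge> 1"
    and "\<And>n. n \<in> {1..N} \<Longrightarrow> P n > 0" and "(\<Sum>n=1..N. P n) = 1"
    and "\<And>a. a \<in> grove_indices M N V \<Longrightarrow> p a \<ge> 0" and "(\<Sum>a\<in>grove_indices M N V. p a) = 1"
  shows "(\<forall>v\<in>{1..V}. component_trees M N V v = component_trees M N V 1) \<and>
    ((\<forall>a\<in>grove_indices M N V. p a = (\<Prod>v=1..V. P (fst (a v))) / real V ^ (M * V)) \<longrightarrow>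
      (\<forall>(S :: 's measure) (\<alpha> :: nat \<Rightarrow> 's \<Rightarrow> grove_index) (x :: nat \<Rightarrow> 's \<Rightarrow> grove) (x1 :: grove).
        prob_space S \<and>
        prob_space.indep_vars S (\<lambda>_. count_space (grove_indices M N V)) \<alpha> {1..} \<and>
        (\<forall>l\<ge>1. \<forall>a\<in>grove_indices M N V. measure S {s \<in> space S. \<alpha> l s = a} = p a) \<and>
        x1 \<in> groves M N V \<and>
        (\<forall>s\<in>space S. x 1 s = x1 \<and> (\<forall>l\<ge>1. x (l + 1) s = grove_map M V (\<alpha> l s) (x l s))) \<longrightarrow>
        (AE s in S. \<forall>v\<in>{1..V}.
           weakly_converges (Metric_space.mtopology (code_trees M N) (tree_dist M))
             (empirical_measure (tree_borel M N) (\<lambda>l. x l s v)) (tree_measure M N V p))))"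
proof -
  interpret weighted_code_tree_ifs M N V p
    using assms by unfold_locales
  show ?thesis
  proof (intro conjI ballI impI allI)
    fix v assume "v \<in> {1..V}"
    then show "component_trees M N V v = component_trees M N V 1" by (rule component_trees_eq)
  next
    fix S :: "'s measure" and \<alpha> :: "nat \<Rightarrow> 's \<Rightarrow> grove_index" and x :: "nat \<Rightarrow> 's \<Rightarrow> grove" and x1
    assume sym: "\<forall>a\<in>I. p a = (\<Prod>v=1..V. P (fst (a v))) / real V ^ (M * V)"
      and S: "prob_space S \<and>
        prob_space.indep_vars S (\<lambda>_. count_space I) \<alpha> {1..} \<and>
        (\<forall>l\<ge>1. \<forall>a\<in>I. measure S {s \<in> space S. \<alpha> l s = a} = p a) \<and>
        x1 \<in> G \<and>
        (\<forall>s\<in>space S. x 1 s = x1 \<and> (\<forall>l\<ge>1. x (l + 1) s = \<eta> (\<alpha> l s) (x l s)))"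
    show "AE s in S. \<forall>v\<in>{1..V}. weakly_converges tree.mtopology
        (empirical_measure (tree_borel M N) (\<lambda>l. x l s v)) (tree_measure M N V p)"
      using sym S by (intro empirical_measures_converge[where c = "real V ^ (M * V)" and P = P and \<alpha> = \<alpha>]) auto
  qed
qed

end
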